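(* For every $\theta_1,\theta_2>0$ with $\theta:=\theta_1+\theta_2>1$, there exists a compactly supported Lipschitz continuous function $u\in\mathrm{Lip}(\mathbf{R}^2)$ with $\mathcal{E}_{1+\theta}^{\theta_1,\theta_2}(u)<\infty$ and for which the distribution $\mu[u]=\partial_1\partial_2u$ is not a finite Radon measure on $\mathbf{R}^2$.
   Context: Here $n_1=n_2=1$, $X_1=\mathbf{R}\times\{0\}$, $X_2=\{0\}\times\mathbf{R}$, the domain is the whole plane $\mathbf{R}^2$, and $z\in\mathbf{R}^2$ is written $z=z_1+z_2$ with $z_l\in X_l$. $\rho\in L^1(\mathbf{R}^2,[0,\infty))$ is a fixed radial function with $\int\rho=1$ and $\operatorname{supp}\rho\subset B_1$ (unit ball centered at $0$); $\rho_\varepsilon(z):=\varepsilon^{-2}\rho(z/\varepsilon)$. For $p,\theta_1,\theta_2>0$ and measurable $u:\mathbf{R}^2\to\mathbf{R}$, $$\mathcal{E}_{\varepsilon,p}^{\theta_1,\theta_2}(u):=\int_{\mathbf{R}^2}\rho_\varepsilon(z)\int_{\mathbf{R}^2}\frac{|u(x+z_1)-u(x)|^{\theta_1}\,|u(x+z_2)-u(x)|^{\theta_2}}{|z|^p}\,dx\,dz,\qquad \mathcal{E}_p^{\theta_1,\theta_2}(u):=\liminf_{\varepsilon\downarrow 0}\mathcal{E}_{\varepsilon,p}^{\theta_1,\theta_2}(u).$$ $\partial_1\partial_2u$ is the mixed second derivative in the sense of distributions. *)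

theory Defs
  imports "HOL-Analysis.Analysis"
begin

type_synonym plane = "real \<times> real"

definition closed_support :: "('a::topological_space \<Rightarrow> real) \<Rightarrow> 'a set" where
  "closed_support f = closure (support_on UNIV f)"

(* Support of an almost-everywhere class of functions: the complement of the
   largest open set on which f vanishes almost everywhere. *)
definition ess_support :: "('a::euclidean_space \<Rightarrow> real) \<Rightarrow> 'a set" where
  "ess_support f = - \<Union>{U. open U \<and> (AE x in lebesgue. x \<in> U \<longrightarrow> f x = 0)}"

(* The closed unit ball is used here; this admits in particular every kernel
   whose support lies in the open unit ball. *)
definition radial_kernel :: "(plane \<Rightarrow> real) \<Rightarrow> bool" where
  "radial_kernel \<rho> \<longleftrightarrow>
     integrable lebesgue \<rho> \<and> (\<forall>z. 0 \<le> \<rho> z) \<and>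
     (\<forall>z w. norm z = norm w \<longrightarrow> \<rho> z = \<rho> w) \<and>
     integral\<^sup>L lebesgue \<rho> = 1 \<and>
     ess_support \<rho> \<subseteq> cball 0 1"

definition rescaled :: "(plane \<Rightarrow> real) \<Rightarrow> real \<Rightarrow> plane \<Rightarrow> real" where
  "rescaled \<rho> \<epsilon> z = \<rho> (z /\<^sub>R \<epsilon>) / \<epsilon>\<^sup>2"

(* The integrals are extended nonnegative integrals, so infinite energy is the value top.
   The integrand's value at z = 0, where division by zero occurs, is irrelevant: a null set. *)
definition energy_eps ::
    "(plane \<Rightarrow> real) \<Rightarrow> real \<Rightarrow> real \<Rightarrow> real \<Rightarrow> real \<Rightarrow> (plane \<Rightarrow> real) \<Rightarrow> ennreal" where
  "energy_eps \<rho> \<epsilon> p \<theta>\<^sub>1 \<theta>\<^sub>2 u =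
     (\<integral>\<^sup>+ z. ennreal (rescaled \<rho> \<epsilon> z) *
       (\<integral>\<^sup>+ x. ennreal (\<bar>u (x + (fst z, 0)) - u x\<bar> powr \<theta>\<^sub>1 *
                       \<bar>u (x + (0, snd z)) - u x\<bar> powr \<theta>\<^sub>2 / norm z powr p)
        \<partial>lebesgue) \<partial>lebesgue)"

definition energy ::
    "(plane \<Rightarrow> real) \<Rightarrow> real \<Rightarrow> real \<Rightarrow> real \<Rightarrow> (plane \<Rightarrow> real) \<Rightarrow> ennreal" where
  "energy \<rho> p \<theta>\<^sub>1 \<theta>\<^sub>2 u = Liminf (at_right 0) (\<lambda>\<epsilon>. energy_eps \<rho> \<epsilon> p \<theta>\<^sub>1 \<theta>\<^sub>2 u)"

definition dir_deriv :: "'a \<Rightarrow> ('a::euclidean_space \<Rightarrow> real) \<Rightarrow> 'a \<Rightarrow> real" where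
  "dir_deriv b f x = frechet_derivative f (at x) b"

primrec C_class :: "nat \<Rightarrow> ('a::euclidean_space \<Rightarrow> real) \<Rightarrow> bool" where
  "C_class 0 f \<longleftrightarrow> continuous_on UNIV f"
| "C_class (Suc k) f \<longleftrightarrow>
     (\<forall>x. f differentiable (at x)) \<and> (\<forall>b\<in>Basis. C_class k (dir_deriv b f))"

definition test_function :: "('a::euclidean_space \<Rightarrow> real) \<Rightarrow> bool" where
  "test_function \<phi> \<longleftrightarrow> (\<forall>k. C_class k \<phi>) \<and> compact (closed_support \<phi>)"

(* A distribution is represented by a functional on all real functions, of which only
   the values at test functions are meaningful. *)
type_synonym 'a distribution = "('a \<Rightarrow> real) \<Rightarrow> real"

definition regular_distribution :: "('a::euclidean_space \<Rightarrow> real) \<Rightarrow> 'a distribution" where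
  "regular_distribution u \<phi> = integral\<^sup>L lebesgue (\<lambda>x. u x * \<phi> x)"

definition distr_deriv :: "'a \<Rightarrow> 'a::euclidean_space distribution \<Rightarrow> 'a distribution" where
  "distr_deriv b T \<phi> = - T (dir_deriv b \<phi>)"

definition mixed_derivative :: "(plane \<Rightarrow> real) \<Rightarrow> plane distribution" where
  "mixed_derivative u =
     distr_deriv (1, 0) (distr_deriv (0, 1) (regular_distribution u))"

definition finite_radon_measure :: "'a::euclidean_space measure \<Rightarrow> bool" where
  "finite_radon_measure M \<longleftrightarrow>
     sets M = sets borel \<and> finite_measure M \<and>
     (\<forall>B\<in>sets borel. emeasure M B = (SUP K\<in>{K. K \<subseteq> B \<and> compact K}. emeasure M K))"

(* Finite signed Radon measures are the differences of finite nonnegative ones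
   (Jordan decomposition). *)
definition is_finite_radon_measure :: "'a::euclidean_space distribution \<Rightarrow> bool" where
  "is_finite_radon_measure T \<longleftrightarrow>
     (\<exists>M N. finite_radon_measure M \<and> finite_radon_measure N \<and>
       (\<forall>\<phi>. test_function \<phi> \<longrightarrow> T \<phi> = integral\<^sup>L M \<phi> - integral\<^sup>L N \<phi>))"

end

theory Submission
  imports Defs
begin

text \<open>
  If the gradient of \<open>u\<close> jumps from \<open>(s, 0)\<close> to \<open>(0, s)\<close> across a segment of length \<open>L\<close>, then the mixed derivative
  has mass of order \<open>s L\<close> on the segment, while the energy is only of order \<open>s^\<theta> L\<close>: for a shift by \<open>z\<close> both
  increments are nonzero only in a strip of width \<open>O(norm z)\<close> around the segment, where they are at most \<open>s norm z\<close>.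
  Away from such creases, the two increments should never be nonzero simultaneously. As \<open>\<theta> > 1\<close>, it is enough to
  arrange creases with slopes \<open>s\<close> tending to zero such that the sum of \<open>s L\<close> diverges and that of \<open>s^\<theta> L\<close> converges.

  The function \<open>min (f x) (f y)\<close>, with a triangle wave \<open>f\<close>, is a grid of pyramids with square bases, the creases
  being the diagonals of the squares. Let \<open>u\<close> consist of blocks of this type, the block number \<open>k\<close> having slope \<open>2^(-mk)\<close> and
  side \<open>2^(-k) / 2\<close> and \<open>2^((m+1)k)\<close> cells in each row, where \<open>m (\<theta> - 1) \<ge> 1\<close>. All blocks contribute
  the same mass to the mixed derivative, and geometrically decreasing amounts to the energy.

  The blocks lie along the diagonal of the plane with disjoint projections to the axes. Two different blocks still interact
  in the energy, through the points \<open>x\<close> in the row of one of them and the column of the other. But then \<open>norm z\<close> is at least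
  comparable to both coordinates of \<open>x\<close>, the integrand is at most \<open>1 / norm z\<close>, and this is bounded by a multiple of
  the integrable function \<open>(x\<^sub>1 x\<^sub>2)^(-1/2)\<close>. Together this bounds the inner integral of the energy uniformly in \<open>z\<close>
  (\<open>inner_integral_bound\<close>), hence the energy at every scale \<open>\<epsilon>\<close>.

  If the mixed derivative were \<open>M - N\<close> with finite measures \<open>M\<close> and \<open>N\<close>, testing it with a smooth bump on the upper right
  quarter of a cell, where the mixed derivative is a positive measure on the crease, would bound the \<open>M\<close>-measure of
  this quarter from below (\<open>measure_quarter_cell\<close>). The quarters are disjoint and the bounds have a divergent sum
  (\<open>pyramids_not_measure\<close>).
\<close>

section \<open>Triangle waves\<close>

text \<open>The distance from a real number to the nearest integer, a triangle wave of period 1.\<close>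

definition dist_int :: "real \<Rightarrow> real" where "dist_int x = \<bar>x - of_int (round x)\<bar>"

lemma dist_int_le: "dist_int x \<le> \<bar>x - of_int j\<bar>"
  unfolding dist_int_def using round_diff_minimal[of x j] by simp

lemma dist_int_nonneg: "0 \<le> dist_int x" by (simp add: dist_int_def)

lemma dist_int_le_half: "dist_int x \<le> 1/2"
  unfolding dist_int_def using of_int_round_abs_le[of x] by (simp add: abs_minus_commute)

lemma dist_int_lip: "\<bar>dist_int x - dist_int y\<bar> \<le> \<bar>x - y\<bar>"
proof -
  have "dist_int x \<le> \<bar>x - y\<bar> + dist_int y" for x y
    using dist_int_le[of x "round y"] unfolding dist_int_def[of y] by linarith
  from this[of x y] this[of y x] show ?thesis by linarith
qed

lemma dist_int_eq:
  assumes "\<bar>x - of_int j\<bar> \<le> 1/2" shows "dist_int x = \<bar>x - of_int j\<bar>"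
proof (rule antisym)
  show "\<bar>x - of_int j\<bar> \<le> dist_int x"
  proof (cases "round x = j")
    case False
    then have "\<bar>real_of_int (round x) - of_int j\<bar> \<ge> 1"
      by linarith
    then show ?thesis using assms unfolding dist_int_def by linarith
  qed (simp add: dist_int_def)
qed (rule dist_int_le)

text \<open>The triangle wave with slopes \<open>\<plusminus>1\<close> whose \<open>n\<close> teeth have width \<open>l\<close> and fill
  \<open>[a, a + n l]\<close>. The clamping makes it vanish outside this interval, because \<^const>\<open>dist_int\<close> vanishes at
  \<open>0\<close> and \<open>n\<close>; it also makes the wave a composition of Lipschitz maps.\<close>

definition wave :: "real \<Rightarrow> real \<Rightarrow> nat \<Rightarrow> real \<Rightarrow> real" where
  "wave a l n t = l * dist_int (max 0 (min (real n) ((t - a) / l)))"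

lemma wave_lip:
  assumes "l > 0" shows "\<bar>wave a l n t - wave a l n t'\<bar> \<le> \<bar>t - t'\<bar>"
proof -
  let ?c = "\<lambda>t. max 0 (min (real n) ((t - a) / l))"
  have "\<bar>wave a l n t - wave a l n t'\<bar> = l * \<bar>dist_int (?c t) - dist_int (?c t')\<bar>"
    using assms by (simp add: wave_def abs_mult flip: right_diff_distrib)
  also have "\<dots> \<le> l * \<bar>?c t - ?c t'\<bar>"
    using assms dist_int_lip by (intro mult_left_mono) auto
  also have "\<dots> \<le> l * \<bar>(t - a) / l - (t' - a) / l\<bar>"
    using assms by (intro mult_left_mono) auto
  also have "\<dots> = \<bar>l * ((t - a) / l - (t' - a) / l)\<bar>"
    using assms by (simp add: abs_mult)
  also have "l * ((t - a) / l - (t' - a) / l) = t - t'"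
    using assms by (simp add: field_simps)
  finally show ?thesis .
qed

lemma wave_nonneg: "l > 0 \<Longrightarrow> 0 \<le> wave a l n t"
  by (simp add: wave_def dist_int_nonneg)

lemma wave_le: "l > 0 \<Longrightarrow> wave a l n t \<le> l / 2"
  using mult_left_mono[OF dist_int_le_half, of l] by (simp add: wave_def)

lemma wave_eq_0:
  assumes "l > 0" "t \<notin> {a..a + n * l}" shows "wave a l n t = 0"
proof (cases "t < a")
  case True
  then have "(t - a) / l < 0" using assms by (simp add: field_simps)
  then have "max 0 (min (real n) ((t - a) / l)) = of_int 0" by simp
  then show ?thesis using dist_int_eq[of 0 0] by (simp add: wave_def)
next
  case False
  then have "(t - a) / l > n" using assms by (simp add: field_simps)
  then have "max 0 (min (real n) ((t - a) / l)) = of_int (int n)" by simp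
  then show ?thesis using dist_int_eq[of "real n" "int n"] by (simp add: wave_def)
qed

lemma wave_near_grid:
  assumes "l > 0" "t \<in> {a..a + n * l}" "\<bar>t - (a + real j * l)\<bar> \<le> l / 2"
  shows "wave a l n t = \<bar>t - (a + real j * l)\<bar>"
proof -
  have "(t - a) / l \<le> n" "0 \<le> (t - a) / l" using assms by (simp_all add: field_simps)
  then have "wave a l n t = l * dist_int ((t - a) / l)" by (simp add: wave_def)
  also have eq: "(t - a) / l - of_int (int j) = (t - (a + real j * l)) / l"
    using assms by (simp add: field_simps)
  have "dist_int ((t - a) / l) = \<bar>(t - a) / l - of_int (int j)\<bar>"
    by (rule dist_int_eq) (use assms in \<open>simp only: eq, simp add: field_simps\<close>)
  also note eq
  also have "l * \<bar>(t - (a + real j * l)) / l\<bar> = \<bar>t - (a + real j * l)\<bar>"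
    using assms by (simp add: abs_divide)
  finally show ?thesis .
qed

lemma wave_grid:
  assumes "l > 0" "t \<in> {a..a + n * l}"
  shows "\<exists>j\<le>n. wave a l n t = \<bar>t - (a + real j * l)\<bar>"
proof -
  define j where "j = round ((t - a) / l)"
  have b: "0 \<le> (t - a) / l" "(t - a) / l \<le> n" using assms by (simp_all add: field_simps)
  have j0: "j \<ge> 0" using round_mono[OF b(1)] by (simp add: j_def)
  have jn: "j \<le> n" using round_mono[OF b(2)] by (simp add: j_def)
  have "\<bar>of_int j - (t - a) / l\<bar> \<le> 1/2" unfolding j_def by (rule of_int_round_abs_le)
  then have "l * \<bar>(t - a) / l - of_int j\<bar> \<le> l * (1/2)"
    using assms by (intro mult_left_mono) (auto simp: abs_minus_commute)
  moreover have "l * \<bar>(t - a) / l - of_int j\<bar> = \<bar>l * ((t - a) / l - of_int j)\<bar>"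
    using assms by (simp add: abs_mult)
  moreover have "l * ((t - a) / l - of_int j) = t - (a + real (nat j) * l)"
    using assms j0 by (simp add: field_simps)
  ultimately have "\<bar>t - (a + real (nat j) * l)\<bar> \<le> l / 2" by simp
  then show ?thesis using wave_near_grid[OF assms, of "nat j"] jn by (intro exI[of _ "nat j"]) simp
qed

text \<open>A wave with \<open>n\<close> teeth takes values within \<open>\<delta>\<close> of a given level only on a set of measure
  \<open>O((n + 1) \<delta>)\<close>: close to each of the \<open>n + 1\<close> grid points it is the distance to that point.\<close>

lemma emeasure_wave_level:
  assumes "l > 0" "\<delta> \<ge> 0"
  shows "emeasure lborel {t \<in> {a..a + n * l}. \<bar>wave a l n t - y\<bar> \<le> \<delta>} \<le> ennreal (4 * (real n + 1) * \<delta>)"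
proof -
  let ?B = "\<lambda>j. {a + real j * l + y - \<delta> .. a + real j * l + y + \<delta>} \<union> {a + real j * l - y - \<delta> .. a + real j * l - y + \<delta>}"
  have "{t \<in> {a..a + n * l}. \<bar>wave a l n t - y\<bar> \<le> \<delta>} \<subseteq> (\<Union>j\<le>n. ?B j)"
  proof
    fix t assume t: "t \<in> {t \<in> {a..a + n * l}. \<bar>wave a l n t - y\<bar> \<le> \<delta>}"
    then obtain j where "j \<le> n" "wave a l n t = \<bar>t - (a + real j * l)\<bar>"
      using wave_grid[OF assms(1)] by blast
    moreover from this t have "t \<in> ?B j" by (simp add: abs_if split: if_splits)
    ultimately show "t \<in> (\<Union>j\<le>n. ?B j)" by blast
  qed
  then have "emeasure lborel {t \<in> {a..a + n * l}. \<bar>wave a l n t - y\<bar> \<le> \<delta>} \<le> emeasure lborel (\<Union>j\<le>n. ?B j)"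
    by (intro emeasure_mono) auto
  also have "\<dots> \<le> (\<Sum>j\<le>n. emeasure lborel (?B j))"
    by (intro emeasure_subadditive_finite) auto
  also have "\<dots> \<le> (\<Sum>j\<le>n. ennreal (4 * \<delta>))"
  proof (intro sum_mono)
    fix j
    have "emeasure lborel (?B j) \<le> emeasure lborel {a + real j * l + y - \<delta> .. a + real j * l + y + \<delta>}
       + emeasure lborel {a + real j * l - y - \<delta> .. a + real j * l - y + \<delta>}"
      by (intro emeasure_subadditive) auto
    also have "\<dots> = ennreal (4 * \<delta>)"
      using assms by (simp flip: ennreal_plus)
    finally show "emeasure lborel (?B j) \<le> ennreal (4 * \<delta>)" .
  qed
  also have "\<dots> = ennreal (4 * (real n + 1) * \<delta>)"
    using assms by (simp add: ennreal_of_nat_eq_real_of_nat algebra_simps flip: ennreal_mult)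
  finally show ?thesis .
qed

section \<open>Smooth bumps\<close>

text \<open>The functions \<open>p(1/t) exp(-1/t)\<close>, for \<open>p\<close> a polynomial, extended by \<open>0\<close> to \<open>t \<le> 0\<close>. They are
  closed under differentiation, which acts on \<open>p\<close> as \<open>flat_deriv\<close>.\<close>

definition flat_exp :: "real poly \<Rightarrow> real \<Rightarrow> real" where
  "flat_exp p t = (if t > 0 then poly p (inverse t) * exp (- inverse t) else 0)"

definition flat_deriv :: "real poly \<Rightarrow> real poly" where
  "flat_deriv p = monom 1 2 * (p - pderiv p)"

lemma poly_div_exp_tendsto_0: "((\<lambda>y. poly p y / exp y) \<longlongrightarrow> (0::real)) at_top"
proof -
  have "((\<lambda>y. \<Sum>i\<le>degree p. coeff p i * (y ^ i / exp y)) \<longlongrightarrow> (\<Sum>i\<le>degree p. coeff p i * 0)) at_top"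
    by (intro tendsto_sum tendsto_mult tendsto_const tendsto_power_div_exp_0)
  then show ?thesis by (simp add: poly_altdef sum_divide_distrib)
qed

lemma flat_exp_tendsto_0: "(flat_exp p \<longlongrightarrow> 0) (at 0)"
proof -
  have "((\<lambda>t. poly p (inverse t) / exp (inverse t)) \<longlongrightarrow> 0) (at_right (0::real))"
    by (rule filterlim_compose[OF poly_div_exp_tendsto_0 filterlim_inverse_at_top_right])
  then have "(flat_exp p \<longlongrightarrow> 0) (at_right 0)"
    by (rule tendsto_cong[THEN iffD1, rotated])
       (auto simp: eventually_at_filter flat_exp_def exp_minus divide_inverse)
  moreover have "(flat_exp p \<longlongrightarrow> 0) (at_left 0)"
    by (rule tendsto_eventually) (auto simp: eventually_at_filter flat_exp_def)
  ultimately show ?thesis by (simp add: filterlim_at_split)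
qed

lemma flat_exp_has_derivative:
  "(flat_exp p has_real_derivative flat_exp (flat_deriv p) t) (at t)"
proof (cases t "0::real" rule: linorder_cases)
  case less
  have "((\<lambda>t. 0) has_real_derivative flat_exp (flat_deriv p) t) (at t)"
    using less by (simp add: flat_exp_def)
  then show ?thesis
    by (rule has_field_derivative_transform_within_open[where S="{..<0}"]) (use less in \<open>auto simp: flat_exp_def\<close>)
next
  case equal
  \<comment> \<open>the difference quotient at \<open>0\<close> is again a function of this type\<close>
  have "((\<lambda>h. flat_exp (pCons 0 p) h) \<longlongrightarrow> 0) (at 0)" by (rule flat_exp_tendsto_0)
  then have "((\<lambda>h. (flat_exp p (0 + h) - flat_exp p 0) / h) \<longlongrightarrow> 0) (at 0)"
    by (rule tendsto_cong[THEN iffD1, rotated])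
       (auto simp: eventually_at_filter flat_exp_def field_simps)
  then show ?thesis using equal by (simp add: DERIV_def) (simp add: flat_exp_def)
next
  case greater
  have "((\<lambda>t. poly p (inverse t) * exp (- inverse t)) has_real_derivative flat_exp (flat_deriv p) t) (at t)"
    using greater
    by (auto intro!: derivative_eq_intros DERIV_chain'[OF _ poly_DERIV]
        simp: flat_exp_def flat_deriv_def poly_monom power2_eq_square algebra_simps)
  then show ?thesis
    by (rule has_field_derivative_transform_within_open[where S="{0<..}"]) (use greater in \<open>auto simp: flat_exp_def\<close>)
qed

text \<open>The algebra generated by these functions composed with affine functions. It is closed under directional
  derivatives, so all its members are smooth.\<close>

inductive flat_alg :: "('a::euclidean_space \<Rightarrow> real) \<Rightarrow> bool" where
  base: "flat_alg (\<lambda>x. flat_exp p (x \<bullet> v + c))"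
| add: "flat_alg f \<Longrightarrow> flat_alg g \<Longrightarrow> flat_alg (\<lambda>x. f x + g x)"
| mult: "flat_alg f \<Longrightarrow> flat_alg g \<Longrightarrow> flat_alg (\<lambda>x. f x * g x)"

lemma dir_deriv_eq:
  assumes "\<And>x. (f has_derivative f' x) (at x)"
  shows "dir_deriv b f = (\<lambda>x. f' x b)"
  unfolding dir_deriv_def using frechet_derivative_at[OF assms] by (intro ext) simp

lemma flat_alg_deriv:
  assumes "flat_alg f"
  shows "(\<forall>x. f differentiable (at x)) \<and> (\<forall>b. flat_alg (dir_deriv b f))"
  using assms
proof induction
  case (base p v c)
  have *: "((\<lambda>x. flat_exp p (x \<bullet> v + c)) has_derivative
        (\<lambda>h. flat_exp (flat_deriv p) (x \<bullet> v + c) * (h \<bullet> v))) (at x)" for x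
  proof -
    have "((\<lambda>x. x \<bullet> v + c) has_derivative (\<lambda>h. h \<bullet> v)) (at x)"
      by (auto intro!: derivative_eq_intros)
    from has_derivative_compose[OF this has_field_derivative_imp_has_derivative[OF flat_exp_has_derivative]]
    show ?thesis by simp
  qed
  \<comment> \<open>the polynomial absorbs the scalar factor\<close>
  have "flat_alg (\<lambda>x. flat_exp (smult (b \<bullet> v) (flat_deriv p)) (x \<bullet> v + c))" for b
    by (rule flat_alg.base)
  moreover have "dir_deriv b (\<lambda>x. flat_exp p (x \<bullet> v + c)) =
      (\<lambda>x. flat_exp (smult (b \<bullet> v) (flat_deriv p)) (x \<bullet> v + c))" for b
    by (subst dir_deriv_eq[OF *]) (auto simp: flat_exp_def)
  ultimately show ?case using * by (auto intro: differentiableI)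
next
  case (add f g)
  have *: "((\<lambda>x. f x + g x) has_derivative
     (\<lambda>h. frechet_derivative f (at x) h + frechet_derivative g (at x) h)) (at x)" for x
    using add.IH by (intro has_derivative_add) (auto simp: frechet_derivative_works[symmetric])
  have "dir_deriv b (\<lambda>x. f x + g x) = (\<lambda>x. dir_deriv b f x + dir_deriv b g x)" for b
    by (subst dir_deriv_eq[OF *]) (simp add: dir_deriv_def)
  with add.IH * show ?case by (auto intro!: differentiableI flat_alg.add)
next
  case (mult f g)
  have *: "((\<lambda>x. f x * g x) has_derivative
     (\<lambda>h. f x * frechet_derivative g (at x) h + frechet_derivative f (at x) h * g x)) (at x)" for x
    using mult.IH by (intro has_derivative_mult) (auto simp: frechet_derivative_works[symmetric])
  have "dir_deriv b (\<lambda>x. f x * g x) = (\<lambda>x. f x * dir_deriv b g x + dir_deriv b f x * g x)" for b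
    by (subst dir_deriv_eq[OF *]) (simp add: dir_deriv_def)
  with mult * show ?case by (auto intro!: differentiableI flat_alg.add flat_alg.mult)
qed

lemma flat_alg_C_class: "flat_alg f \<Longrightarrow> C_class k f"
proof (induction k arbitrary: f)
  case 0
  then show ?case
    using flat_alg_deriv[OF 0]
    by (simp add: continuous_on_eq_continuous_at differentiable_imp_continuous_within)
next
  case (Suc k)
  then show ?case using flat_alg_deriv[of f] by simp
qed

text \<open>A smooth bump with support \<open>[0, 1]\<close>, and its derivative \<open>bump'\<close>.\<close>

definition bump :: "real \<Rightarrow> real" where
  "bump t = flat_exp 1 t * flat_exp 1 (1 - t)"

definition bump' :: "real \<Rightarrow> real" where
  "bump' t = flat_exp (flat_deriv 1) t * flat_exp 1 (1 - t) - flat_exp 1 t * flat_exp (flat_deriv 1) (1 - t)"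

lemma bump_deriv: "(bump has_real_derivative bump' t) (at t)"
  unfolding bump_def bump'_def
  by (auto intro!: derivative_eq_intros DERIV_chain'[OF _ flat_exp_has_derivative])

lemma bump'_differentiable: "\<exists>d. (bump' has_real_derivative d) (at t)"
  unfolding bump'_def
  by (auto intro!: exI derivative_eq_intros DERIV_chain'[OF _ flat_exp_has_derivative])

lemma bump_eq_0: "t \<notin> {0<..<1} \<Longrightarrow> bump t = 0"
  by (auto simp: bump_def flat_exp_def)

lemma bump'_eq_0: "t \<notin> {0<..<1} \<Longrightarrow> bump' t = 0"
  by (auto simp: bump'_def flat_exp_def)

lemma bump_nonneg: "0 \<le> bump t"
  by (simp add: bump_def flat_exp_def)

lemma bump_le_1: "bump t \<le> 1"
  by (simp add: bump_def flat_exp_def mult_le_one)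

text \<open>The product bump on the square with lower left corner \<open>p\<close> and side \<open>h\<close>.\<close>

definition tensor_bump :: "real \<Rightarrow> plane \<Rightarrow> plane \<Rightarrow> real" where
  "tensor_bump h p x = bump ((fst x - fst p) / h) * bump ((snd x - snd p) / h)"

lemma tensor_bump_flat_alg: "flat_alg (tensor_bump h p)"
proof -
  have *: "flat_alg (\<lambda>x. bump (x \<bullet> v + c))" for v :: plane and c
  proof -
    have "flat_alg (\<lambda>x. flat_exp 1 (x \<bullet> v + c) * flat_exp 1 (x \<bullet> (- v) + (1 - c)))"
      by (intro flat_alg.intros)
    then show ?thesis by (simp add: bump_def algebra_simps)
  qed
  have "flat_alg (\<lambda>x. bump (x \<bullet> (1/h, 0) + - fst p / h) * bump (x \<bullet> (0, 1/h) + - snd p / h))"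
    by (intro flat_alg.mult *)
  then show ?thesis by (simp add: tensor_bump_def[abs_def] inner_prod_def diff_divide_distrib)
qed

lemma tensor_bump_eq_0:
  assumes "h > 0" "x \<notin> box p (p + (h, h))"
  shows "tensor_bump h p x = 0"
proof -
  have "\<not> ((fst x - fst p) / h \<in> {0<..<1} \<and> (snd x - snd p) / h \<in> {0<..<1})"
    using assms by (cases x; cases p) (auto simp: box_def Basis_prod_def field_simps)
  then show ?thesis using bump_eq_0 by (auto simp: tensor_bump_def)
qed

lemma tensor_bump_test:
  assumes "h > 0" shows "test_function (tensor_bump h p)"
proof -
  have "support_on UNIV (tensor_bump h p) \<subseteq> cbox p (p + (h, h))"
    using tensor_bump_eq_0[OF assms, of _ p] box_subset_cbox[of p "p + (h, h)"] unfolding support_on_def by blast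
  then have "closed_support (tensor_bump h p) \<subseteq> cbox p (p + (h, h))"
    unfolding closed_support_def by (rule closure_minimal) (rule closed_cbox)
  then have "compact (closed_support (tensor_bump h p))"
    using compact_cbox closed_support_def
    by (metis closed_Int_compact closed_closure inf.absorb1)
  then show ?thesis by (simp add: test_function_def flat_alg_C_class tensor_bump_flat_alg)
qed

lemma dir_deriv_tensor:
  assumes f: "\<And>t. (f has_real_derivative f' t) (at t)" and g: "\<And>t. (g has_real_derivative g' t) (at t)"
  shows "dir_deriv b (\<lambda>x::plane. f (fst x) * g (snd x)) =
    (\<lambda>x. fst b * f' (fst x) * g (snd x) + snd b * f (fst x) * g' (snd x))"
proof -
  have "((\<lambda>x::plane. f (fst x) * g (snd x)) has_derivative
     (\<lambda>b. f (fst x) * (g' (snd x) * snd b) + f' (fst x) * fst b * g (snd x))) (at x)" for x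
  proof (intro has_derivative_mult)
    show "((\<lambda>x. f (fst x)) has_derivative (\<lambda>b. f' (fst x) * fst b)) (at x)"
      by (rule has_derivative_compose[OF has_derivative_fst[OF has_derivative_ident] has_field_derivative_imp_has_derivative[OF f]])
    show "((\<lambda>x. g (snd x)) has_derivative (\<lambda>b. g' (snd x) * snd b)) (at x)"
      by (rule has_derivative_compose[OF has_derivative_snd[OF has_derivative_ident] has_field_derivative_imp_has_derivative[OF g]])
  qed
  from dir_deriv_eq[OF this] show ?thesis by (simp add: algebra_simps)
qed

lemma mixed_derivative_tensor_bump:
  assumes "h > 0"
  shows "mixed_derivative u (tensor_bump h p) =
    (\<integral>x. u x * (bump' ((fst x - fst p) / h) / h * (bump' ((snd x - snd p) / h) / h)) \<partial>lebesgue)"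
proof -
  let ?a = "\<lambda>c t. bump ((t - c) / h)" and ?a' = "\<lambda>c t. bump' ((t - c) / h) / h"
  have 1: "(?a c has_real_derivative ?a' c t) (at t)" for c t
  proof -
    have "((\<lambda>t. (t - c) / h) has_real_derivative 1 / h) (at t)"
      using assms by (auto intro!: derivative_eq_intros)
    from DERIV_chain'[OF this bump_deriv] show ?thesis by simp
  qed
  obtain d where d: "\<And>t. (bump' has_real_derivative d t) (at t)"
    using bump'_differentiable by metis
  have 2: "(?a' c has_real_derivative d ((t - c) / h) / h / h) (at t)" for c t
  proof -
    have "((\<lambda>t. (t - c) / h) has_real_derivative 1 / h) (at t)"
      using assms by (auto intro!: derivative_eq_intros)
    from DERIV_cdivide[OF DERIV_chain'[OF this d]] show ?thesis by simp
  qed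
  have "dir_deriv (1, 0) (tensor_bump h p) = (\<lambda>x. ?a' (fst p) (fst x) * ?a (snd p) (snd x))"
    unfolding tensor_bump_def[abs_def] by (subst dir_deriv_tensor[OF 1 1]) simp
  moreover have "dir_deriv (0, 1) (\<lambda>x. ?a' (fst p) (fst x) * ?a (snd p) (snd x)) =
      (\<lambda>x. ?a' (fst p) (fst x) * ?a' (snd p) (snd x))"
    by (subst dir_deriv_tensor[OF 2 1]) simp
  ultimately show ?thesis
    by (simp add: mixed_derivative_def distr_deriv_def regular_distribution_def)
qed

section \<open>The blocks of pyramids\<close>

text \<open>Block number \<open>k\<close> occupies the square \<open>strip k \<times> strip k\<close> of side \<open>2^(-k) / 2\<close>, whose lower left corner has
  both coordinates equal to \<open>left_end k = 2^(-k)\<close>. It consists of \<open>cells m k\<close> times \<open>cells m k\<close> pyramids with slope \<open>slope m k = 2^(-mk)\<close>. The number of cells is chosen such that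
  number of cells per row, side and slope have a product independent of \<open>k\<close> (lemma
  \<open>cells_left_end_slope\<close>), whereas replacing the slope by its power with exponent \<open>\<theta> > 1\<close> makes this product
  summable in \<open>k\<close> as soon as \<open>m (\<theta> - 1) \<ge> 1\<close>.\<close>

definition cells :: "nat \<Rightarrow> nat \<Rightarrow> nat" where "cells m k = 2 ^ ((m + 1) * k)"
definition left_end :: "nat \<Rightarrow> real" where "left_end k = (1/2) ^ k"
definition cell_width :: "nat \<Rightarrow> nat \<Rightarrow> real" where "cell_width m k = left_end k / 2 / cells m k"
definition slope :: "nat \<Rightarrow> nat \<Rightarrow> real" where "slope m k = (1/2) ^ (m * k)"

text \<open>The wave with the teeth of block \<open>k\<close>.\<close>

definition bwave :: "nat \<Rightarrow> nat \<Rightarrow> real \<Rightarrow> real" where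
  "bwave m k = wave (left_end k) (cell_width m k) (cells m k)"

text \<open>The projection of block \<open>k\<close> to either axis.\<close>

definition strip :: "nat \<Rightarrow> real set" where "strip k = {left_end k .. 3/2 * left_end k}"

text \<open>The scaled minimum of the two waves: on each cell of the grid this is a pyramid with square base, whose gradient
  is parallel to one of the axes almost everywhere, and whose creases are the diagonals of the cell.\<close>

definition block :: "nat \<Rightarrow> nat \<Rightarrow> plane \<Rightarrow> real" where
  "block m k x = slope m k * min (bwave m k (fst x)) (bwave m k (snd x))"

text \<open>The sum of all blocks. As at most one of the nonnegative functions \<open>block m k\<close> is nonzero at any given
  point, it is written as a supremum, for which the Lipschitz bound is immediate.\<close>

definition pyramids :: "nat \<Rightarrow> plane \<Rightarrow> real" where
  "pyramids m x = (SUP k. block m k x)"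

lemma cells_pos: "cells m k > 0" by (simp add: cells_def)
lemma left_end_pos: "left_end k > 0" by (simp add: left_end_def)
lemma left_end_le_1: "left_end k \<le> 1" by (simp add: left_end_def power_le_one)
lemma cell_width_pos: "cell_width m k > 0"
  by (simp add: cell_width_def left_end_pos cells_pos)
lemma slope_pos: "slope m k > 0" by (simp add: slope_def)
lemma slope_le_1: "slope m k \<le> 1" by (simp add: slope_def power_le_one)

lemma cells_width: "real (cells m k) * cell_width m k = left_end k / 2"
  using cells_pos[of m k] by (simp add: cell_width_def)

lemma cells_left_end_slope: "real (cells m k) * left_end k * slope m k = 1"
  by (simp add: cells_def left_end_def slope_def power_add power_one_over)

lemma strip_eq: "strip k = {left_end k .. left_end k + real (cells m k) * cell_width m k}"
  by (simp add: strip_def cells_width)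

text \<open>The gap between two strips is comparable to the coordinates of their points.\<close>

lemma strip_gap:
  assumes "s \<in> strip i" "t \<in> strip j" "i \<noteq> j"
  shows "max s t \<le> 6 * \<bar>s - t\<bar>"
proof -
  have *: "max s t \<le> 6 * \<bar>s - t\<bar>" if "s \<in> strip i" "t \<in> strip j" "i < j" for s t i j
  proof -
    have "left_end j \<le> left_end (Suc i)"
      unfolding left_end_def using that by (intro power_decreasing) auto
    then have "left_end j \<le> left_end i / 2" by (simp add: left_end_def)
    then show ?thesis using that left_end_pos[of i] by (auto simp: strip_def abs_if)
  qed
  show ?thesis using *[of s i t j] *[of t j s i] assms by (cases "i < j") (auto simp: max.commute abs_minus_commute)
qed

lemma strip_pos: "s \<in> strip k \<Longrightarrow> 0 < s"
  using left_end_pos[of k] by (auto simp: strip_def)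

lemma strip_le: "s \<in> strip k \<Longrightarrow> s \<le> 2"
  using left_end_le_1[of k] by (auto simp: strip_def)

lemma strip_unique: "s \<in> strip i \<Longrightarrow> s \<in> strip j \<Longrightarrow> i = j"
  using strip_gap[of s i s j] strip_pos[of s i] by auto

lemma bwave_outside: "t \<notin> strip k \<Longrightarrow> bwave m k t = 0"
  unfolding bwave_def by (rule wave_eq_0) (simp_all add: cell_width_pos strip_eq[of k m])

lemma bwave_lip:
  fixes m k :: nat shows "\<bar>bwave m k s - bwave m k t\<bar> \<le> \<bar>s - t\<bar>"
  unfolding bwave_def by (rule wave_lip[OF cell_width_pos])

lemma abs_fst_le: "\<bar>fst z\<bar> \<le> norm (z :: plane)" and abs_snd_le: "\<bar>snd z\<bar> \<le> norm z"
  using norm_fst_le[of "fst z" "snd z"] norm_snd_le[of "snd z" "fst z"] by simp_all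

lemma bwave_nonneg:
  fixes m k :: nat shows "0 \<le> bwave m k t"
  by (simp add: bwave_def wave_nonneg cell_width_pos)

lemma block_nonneg: "0 \<le> block m k x"
  using slope_pos[of m k] by (simp add: block_def bwave_nonneg)

lemma block_outside: "fst x \<notin> strip k \<or> snd x \<notin> strip k \<Longrightarrow> block m k x = 0"
  using bwave_nonneg[of m k] by (auto simp: block_def bwave_outside min_def order.antisym)

lemma block_lip: "\<bar>block m k x - block m k y\<bar> \<le> slope m k * norm (x - y)"
proof -
  have "\<bar>bwave m k (fst x) - bwave m k (fst y)\<bar> \<le> norm (x - y)"
    using bwave_lip[of m k "fst x" "fst y"] abs_fst_le[of "x - y"] by simp
  moreover have "\<bar>bwave m k (snd x) - bwave m k (snd y)\<bar> \<le> norm (x - y)"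
    using bwave_lip[of m k "snd x" "snd y"] abs_snd_le[of "x - y"] by simp
  ultimately have "\<bar>min (bwave m k (fst x)) (bwave m k (snd x)) - min (bwave m k (fst y)) (bwave m k (snd y))\<bar> \<le> norm (x - y)"
    by linarith
  then have "slope m k * \<bar>min (bwave m k (fst x)) (bwave m k (snd x)) - min (bwave m k (fst y)) (bwave m k (snd y))\<bar> \<le> slope m k * norm (x - y)"
    using slope_pos[of m k] by (intro mult_left_mono) auto
  then show ?thesis using slope_pos[of m k] by (simp add: block_def abs_mult flip: right_diff_distrib)
qed

lemma block_le_1: "block m k x \<le> 1"
proof -
  have "cell_width m k / 2 \<le> 1"
  proof -
    have "cell_width m k * 1 \<le> cell_width m k * real (cells m k)"
      using cells_pos[of m k] cell_width_pos[of m k] by (intro mult_left_mono) auto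
    then show ?thesis using cells_width[of m k] left_end_le_1[of k] by (simp add: mult.commute)
  qed
  then have "min (bwave m k (fst x)) (bwave m k (snd x)) \<le> 1"
    using wave_le[OF cell_width_pos[of m k], of "left_end k" "cells m k" "fst x"] by (simp add: bwave_def min_le_iff_disj)
  then show ?thesis unfolding block_def using slope_pos[of m k] slope_le_1[of m k] bwave_nonneg[of m k]
    by (intro mult_le_one) auto
qed

lemma block_bdd: "bdd_above (range (\<lambda>k. block m k x))"
  by (rule bdd_aboveI2[OF block_le_1])

text \<open>It suffices that one coordinate lies in the strip, as the other blocks vanish there.\<close>

lemma pyramids_eq_block:
  assumes "fst x \<in> strip k \<or> snd x \<in> strip k" shows "pyramids m x = block m k x"
proof (rule antisym)
  have "block m i x \<le> block m k x" for i
  proof (cases "i = k")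
    case False
    then have "block m i x = 0" using assms strip_unique block_outside by metis
    then show ?thesis by (simp add: block_nonneg)
  qed simp
  then show "pyramids m x \<le> block m k x" unfolding pyramids_def by (intro cSUP_least) auto
  show "block m k x \<le> pyramids m x" unfolding pyramids_def by (intro cSUP_upper block_bdd) auto
qed

lemma pyramids_eq_0:
  assumes "\<And>k. fst x \<notin> strip k \<or> snd x \<notin> strip k" shows "pyramids m x = 0"
  using block_outside[OF assms] by (simp add: pyramids_def)

lemma pyramids_lip: "\<bar>pyramids m x - pyramids m y\<bar> \<le> norm (x - y)"
proof -
  have "pyramids m x \<le> pyramids m y + norm (x - y)" for x y
  proof -
    have "block m k x \<le> pyramids m y + norm (x - y)" for k
    proof -
      have "block m k x \<le> block m k y + slope m k * norm (x - y)"
        using block_lip[of m k x y] by linarith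
      also have "block m k y \<le> pyramids m y"
        unfolding pyramids_def by (intro cSUP_upper block_bdd) auto
      also have "slope m k * norm (x - y) \<le> norm (x - y)"
        using slope_le_1 slope_pos by (simp add: mult_left_le_one_le order.strict_implies_order)
      finally show ?thesis by simp
    qed
    then show ?thesis unfolding pyramids_def[of m x] by (intro cSUP_least) auto
  qed
  from this[of x y] this[of y x] show ?thesis by (simp add: norm_minus_commute abs_le_iff)
qed

lemma pyramids_lipschitz: "1-lipschitz_on UNIV (pyramids m)"
  by (rule lipschitz_onI) (auto simp: dist_norm pyramids_lip)

lemma pyramids_compact_support: "compact (closed_support (pyramids m))"
proof -
  have "support_on UNIV (pyramids m) \<subseteq> cbox (0, 0) (2, 2)"
  proof
    fix x assume "x \<in> support_on UNIV (pyramids m)"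
    then obtain k where "fst x \<in> strip k" "snd x \<in> strip k"
      using pyramids_eq_0[of x m] by (auto simp: support_on_def)
    then show "x \<in> cbox (0, 0) (2, 2)"
      using strip_pos strip_le by (cases x) (auto simp: cbox_Pair_eq less_imp_le)
  qed
  then have "closed_support (pyramids m) \<subseteq> cbox (0, 0) (2, 2)"
    unfolding closed_support_def by (rule closure_minimal) (rule closed_cbox)
  then show ?thesis
    using compact_cbox closed_support_def
    by (metis closed_Int_compact closed_closure inf.absorb1)
qed

lemma pyramids_diff_le_slope:
  assumes "fst x \<in> strip k \<and> fst y = fst x \<or> snd x \<in> strip k \<and> snd y = snd x"
  shows "\<bar>pyramids m y - pyramids m x\<bar> \<le> slope m k * norm (y - x)"
proof -
  have "pyramids m x = block m k x" "pyramids m y = block m k y"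
    using assms by (auto intro!: pyramids_eq_block)
  then show ?thesis using block_lip[of m k y x] by simp
qed

text \<open>The part of block \<open>k\<close> that is close to the creases, where the two waves have equal values.\<close>

definition near_crease :: "nat \<Rightarrow> nat \<Rightarrow> real \<Rightarrow> plane set" where
  "near_crease m k \<delta> = {x. fst x \<in> strip k \<and> snd x \<in> strip k \<and> \<bar>bwave m k (snd x) - bwave m k (fst x)\<bar> \<le> \<delta>}"

text \<open>A minimum reacts to a change of either argument only if the two arguments are close to each other.\<close>

lemma abs_diff_le_if_min_neq:
  fixes A B C D \<delta> :: real
  assumes "\<bar>A - B\<bar> \<le> \<delta>" "\<bar>D - C\<bar> \<le> \<delta>" "min A C \<noteq> min B C" "min B D \<noteq> min B C"
  shows "\<bar>C - B\<bar> \<le> \<delta>"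
proof -
  have "min A B < C" "min C D < B" using assms(3,4) by (auto simp: min_def split: if_splits)
  with assms(1,2) show ?thesis by linarith
qed

lemma block_creases:
  assumes "block m k (x + (fst z, 0)) \<noteq> block m k x" "block m k (x + (0, snd z)) \<noteq> block m k x"
    and "fst x \<in> strip k" "snd x \<in> strip k"
  shows "x \<in> near_crease m k (norm z)"
proof -
  have "\<bar>bwave m k (fst x + fst z) - bwave m k (fst x)\<bar> \<le> norm z"
    using bwave_lip[of m k "fst x + fst z" "fst x"] abs_fst_le[of z] by simp
  moreover have "\<bar>bwave m k (snd x + snd z) - bwave m k (snd x)\<bar> \<le> norm z"
    using bwave_lip[of m k "snd x + snd z" "snd x"] abs_snd_le[of z] by simp
  moreover have "min (bwave m k (fst x + fst z)) (bwave m k (snd x)) \<noteq> min (bwave m k (fst x)) (bwave m k (snd x))"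
    "min (bwave m k (fst x)) (bwave m k (snd x + snd z)) \<noteq> min (bwave m k (fst x)) (bwave m k (snd x))"
    using assms by (auto simp: block_def)
  ultimately have "\<bar>bwave m k (snd x) - bwave m k (fst x)\<bar> \<le> norm z"
    by (rule abs_diff_le_if_min_neq)
  then show ?thesis using assms by (simp add: near_crease_def)
qed

text \<open>If both increments at \<open>x\<close> are nonzero, then either \<open>x\<close> is close to a crease of some block, or \<open>x\<close> lies
  in the intersection of the row of one block with the column of another one. In the second case \<open>x + z\<close> has
  a coordinate in a different strip, hence \<open>z\<close> is at least comparable to \<open>x\<close>.\<close>

lemma pyramids_moved:
  assumes "pyramids m (x + (fst z, 0)) \<noteq> pyramids m x" "pyramids m (x + (0, snd z)) \<noteq> pyramids m x"
  obtains k where "x \<in> near_crease m k (norm z)"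
  | i j where "i \<noteq> j" "fst x \<in> strip i" "snd x \<in> strip j" "fst x \<le> 6 * norm z" "snd x \<le> 6 * norm z"
proof -
  from assms(1) obtain j where j: "snd x \<in> strip j"
    by (metis add.right_neutral pyramids_eq_0 snd_add snd_conv)
  from assms(2) obtain i where i: "fst x \<in> strip i"
    by (metis add.right_neutral pyramids_eq_0 fst_add fst_conv)
  show thesis
  proof (cases "i = j")
    case True
    then have "x \<in> near_crease m i (norm z)"
      using i j assms by (intro block_creases) (simp_all add: pyramids_eq_block[where k = i])
    then show ?thesis by (rule that(1))
  next
    case False
    \<comment> \<open>\<open>x\<close> lies in no block, so both increments are values of a block at a shifted point\<close>
    have "pyramids m x = 0"
      using False i j strip_unique by (intro pyramids_eq_0) metis
    with assms(1) have "block m j (x + (fst z, 0)) \<noteq> 0"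
      using j by (simp add: pyramids_eq_block[where k = j])
    then have "fst x + fst z \<in> strip j" using block_outside[of "x + (fst z, 0)" j] by auto
    from strip_gap[OF i this False] have "fst x \<le> 6 * norm z" using abs_fst_le[of z] by simp
    moreover
    from \<open>pyramids m x = 0\<close> assms(2) have "block m i (x + (0, snd z)) \<noteq> 0"
      using i by (simp add: pyramids_eq_block[where k = i])
    then have "snd x + snd z \<in> strip i" using block_outside[of "x + (0, snd z)" i] by auto
    from strip_gap[OF j this] False have "snd x \<le> 6 * norm z" using abs_snd_le[of z] by simp
    ultimately show ?thesis using that(2) False i j by blast
  qed
qed

section \<open>Finite energy\<close>

lemma bwave_measurable [measurable]: "bwave m k \<in> borel_measurable borel"
proof -
  have "1-lipschitz_on UNIV (bwave m k)"
    by (rule lipschitz_onI) (auto simp: dist_real_def bwave_lip)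
  then show ?thesis by (intro borel_measurable_continuous_onI) (rule lipschitz_on_continuous_on)
qed

lemma near_crease_measurable [measurable]: "near_crease m k \<delta> \<in> sets borel"
proof -
  have "near_crease m k \<delta> = {x \<in> space borel. fst x \<in> strip k \<and> snd x \<in> strip k \<and>
      \<bar>bwave m k (snd x) - bwave m k (fst x)\<bar> \<le> \<delta>}"
    by (simp add: near_crease_def)
  also have "\<dots> \<in> sets borel"
    unfolding strip_def borel_prod[symmetric] by measurable
  finally show ?thesis .
qed

lemma emeasure_near_crease:
  assumes "\<delta> \<ge> 0"
  shows "emeasure lborel (near_crease m k \<delta>) \<le> ennreal (4 * real (cells m k) * left_end k * \<delta>)"
proof -
  have "emeasure lborel (near_crease m k \<delta>) = (\<integral>\<^sup>+s. emeasure lborel (Pair s -` near_crease m k \<delta>) \<partial>lborel)"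
    by (subst lborel_prod[symmetric], rule lborel.emeasure_pair_measure_alt)
       (simp only: lborel_prod sets_lborel near_crease_measurable)
  also have "\<dots> \<le> (\<integral>\<^sup>+s. ennreal (4 * (real (cells m k) + 1) * \<delta>) * indicator (strip k) s \<partial>lborel)"
  proof (rule nn_integral_mono)
    fix s
    show "emeasure lborel (Pair s -` near_crease m k \<delta>) \<le> ennreal (4 * (real (cells m k) + 1) * \<delta>) * indicator (strip k) s"
    proof (cases "s \<in> strip k")
      case True
      then have "Pair s -` near_crease m k \<delta> =
        {t \<in> {left_end k..left_end k + real (cells m k) * cell_width m k}. \<bar>wave (left_end k) (cell_width m k) (cells m k) t - bwave m k s\<bar> \<le> \<delta>}"
        by (auto simp: near_crease_def bwave_def strip_eq[of k m])
      then show ?thesis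
        using emeasure_wave_level[OF cell_width_pos assms] True by simp
    qed (simp add: near_crease_def vimage_def)
  qed
  also have "\<dots> = ennreal (4 * (real (cells m k) + 1) * \<delta>) * emeasure lborel (strip k)"
    by (rule nn_integral_cmult_indicator) (simp add: strip_def)
  also have "emeasure lborel (strip k) = ennreal (left_end k / 2)"
    using left_end_pos[of k] by (simp add: strip_def)
  also have "ennreal (4 * (real (cells m k) + 1) * \<delta>) * ennreal (left_end k / 2) = ennreal (4 * (real (cells m k) + 1) * \<delta> * (left_end k / 2))"
    using left_end_pos[of k] assms by (intro ennreal_mult[symmetric]) auto
  also have "\<dots> \<le> ennreal (4 * real (cells m k) * left_end k * \<delta>)"
  proof (rule ennreal_leI)
    have "(real (cells m k) + 1) * (2 * \<delta> * left_end k) \<le> (2 * real (cells m k)) * (2 * \<delta> * left_end k)"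
      using cells_pos[of m k] left_end_pos[of k] assms by (intro mult_right_mono) auto
    then show "4 * (real (cells m k) + 1) * \<delta> * (left_end k / 2) \<le> 4 * real (cells m k) * left_end k * \<delta>"
      by (simp add: algebra_simps)
  qed
  finally show ?thesis .
qed

text \<open>The function \<open>t^(-1/2)\<close> on the projection \<open>[0, 2]\<close> of a square that contains all the blocks.\<close>

definition inv_sqrt :: "real \<Rightarrow> ennreal" where
  "inv_sqrt t = indicator {0..2} t * ennreal (t powr (-1/2))"

lemma inv_sqrt_measurable [measurable]: "inv_sqrt \<in> borel_measurable borel"
  unfolding inv_sqrt_def[abs_def] by measurable

lemma nn_integral_inv_sqrt: "(\<integral>\<^sup>+t. inv_sqrt t \<partial>lborel) < \<infinity>"
proof -
  have "((\<lambda>x. x powr (-1/2)) has_integral (2 powr (-1/2+1) / (-1/2+1))) {0..2::real}"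
    by (rule has_integral_powr_from_0) auto
  then have "((\<lambda>x. indicator {0..2} x * x powr (-1/2)) has_integral (2 powr (-1/2+1) / (-1/2+1))) (UNIV::real set)"
    by (subst (asm) has_integral_restrict_UNIV[symmetric])
       (auto simp: indicator_def intro: has_integral_cong[THEN iffD1, rotated])
  then have "(\<integral>\<^sup>+x. ennreal (indicator {0..2} x * x powr (-1/2)) \<partial>lborel) = ennreal (2 powr (-1/2+1) / (-1/2+1))"
    by (intro nn_integral_has_integral_lborel) auto
  moreover have "inv_sqrt x = ennreal (indicator {0..2} x * x powr (-1/2))" for x
    by (simp add: inv_sqrt_def indicator_def)
  ultimately show ?thesis by simp
qed

lemma nn_integral_inv_sqrt_prod:
  "(\<integral>\<^sup>+x. inv_sqrt (fst x) * inv_sqrt (snd x) \<partial>lborel) < \<infinity>"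
proof -
  have "(\<integral>\<^sup>+x. inv_sqrt (fst x) * inv_sqrt (snd x) \<partial>lborel) =
      (\<integral>\<^sup>+s. \<integral>\<^sup>+t. inv_sqrt s * inv_sqrt t \<partial>lborel \<partial>lborel)"
    by (subst lborel_prod[symmetric], subst lborel.nn_integral_fst[symmetric]) (auto simp: lborel_prod borel_prod[symmetric])
  also have "\<dots> = (\<integral>\<^sup>+t. inv_sqrt t \<partial>lborel) * (\<integral>\<^sup>+t. inv_sqrt t \<partial>lborel)"
    by (simp add: nn_integral_cmult nn_integral_multc)
  finally show ?thesis using nn_integral_inv_sqrt by (simp add: ennreal_mult_less_top)
qed

lemma powr_quotient_le:
  fixes A B s \<delta> \<theta>\<^sub>1 \<theta>\<^sub>2 :: real
  assumes "\<bar>A\<bar> \<le> s * \<delta>" "\<bar>B\<bar> \<le> s * \<delta>" "s > 0" "\<delta> > 0" "\<theta>\<^sub>1 > 0" "\<theta>\<^sub>2 > 0"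
  shows "\<bar>A\<bar> powr \<theta>\<^sub>1 * \<bar>B\<bar> powr \<theta>\<^sub>2 / \<delta> powr (1 + (\<theta>\<^sub>1 + \<theta>\<^sub>2)) \<le> s powr (\<theta>\<^sub>1 + \<theta>\<^sub>2) / \<delta>"
proof -
  have "\<bar>A\<bar> powr \<theta>\<^sub>1 * \<bar>B\<bar> powr \<theta>\<^sub>2 \<le> (s * \<delta>) powr \<theta>\<^sub>1 * (s * \<delta>) powr \<theta>\<^sub>2"
    using assms by (intro mult_mono powr_mono2) auto
  also have "\<dots> = s powr (\<theta>\<^sub>1 + \<theta>\<^sub>2) * \<delta> powr (\<theta>\<^sub>1 + \<theta>\<^sub>2)"
    using assms by (simp add: powr_add powr_mult)
  finally have "\<bar>A\<bar> powr \<theta>\<^sub>1 * \<bar>B\<bar> powr \<theta>\<^sub>2 / \<delta> powr (1 + (\<theta>\<^sub>1 + \<theta>\<^sub>2))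
     \<le> s powr (\<theta>\<^sub>1 + \<theta>\<^sub>2) * \<delta> powr (\<theta>\<^sub>1 + \<theta>\<^sub>2) / \<delta> powr (1 + (\<theta>\<^sub>1 + \<theta>\<^sub>2))"
    by (rule divide_right_mono) simp
  also have "\<dots> = s powr (\<theta>\<^sub>1 + \<theta>\<^sub>2) / \<delta>"
    using assms by (simp add: powr_add)
  finally show ?thesis .
qed

text \<open>The integrand of the inner integral of the energy of \<^const>\<open>pyramids\<close>.\<close>

definition diff_quotient :: "nat \<Rightarrow> real \<Rightarrow> real \<Rightarrow> plane \<Rightarrow> plane \<Rightarrow> real" where
  "diff_quotient m \<theta>\<^sub>1 \<theta>\<^sub>2 z x = \<bar>pyramids m (x + (fst z, 0)) - pyramids m x\<bar> powr \<theta>\<^sub>1 *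
      \<bar>pyramids m (x + (0, snd z)) - pyramids m x\<bar> powr \<theta>\<^sub>2 / norm z powr (1 + (\<theta>\<^sub>1 + \<theta>\<^sub>2))"

text \<open>The first sum accounts for the points close to creases. The second term accounts for the interaction of
  different blocks, where both coordinates of \<open>x\<close> are \<open>O(norm z)\<close> and the integrand is at most \<open>1 / norm z\<close>.\<close>

lemma diff_quotient_le_sum:
  assumes "\<theta>\<^sub>1 > 0" "\<theta>\<^sub>2 > 0" "z \<noteq> 0"
  shows "ennreal (diff_quotient m \<theta>\<^sub>1 \<theta>\<^sub>2 z x) \<le>
     (\<Sum>k. ennreal (slope m k powr (\<theta>\<^sub>1 + \<theta>\<^sub>2) / norm z) * indicator (near_crease m k (norm z)) x)
     + 6 * (inv_sqrt (fst x) * inv_sqrt (snd x))"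
proof (cases "pyramids m (x + (fst z, 0)) = pyramids m x \<or> pyramids m (x + (0, snd z)) = pyramids m x")
  case True
  then have "diff_quotient m \<theta>\<^sub>1 \<theta>\<^sub>2 z x = 0" by (auto simp: diff_quotient_def)
  then show ?thesis by simp
next
  case False
  let ?d = "norm z"
  have z: "?d > 0" using assms by simp
  have le_d: "norm (x + (fst z, 0) - x) \<le> ?d" "norm (x + (0, snd z) - x) \<le> ?d"
    using abs_fst_le[of z] abs_snd_le[of z] by simp_all
  from False have "pyramids m (x + (fst z, 0)) \<noteq> pyramids m x" "pyramids m (x + (0, snd z)) \<noteq> pyramids m x"
    by auto
  then show ?thesis
  proof (cases rule: pyramids_moved)
    case (1 k)
    then have k: "fst x \<in> strip k" "snd x \<in> strip k" by (auto simp: near_crease_def)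
    have "\<bar>pyramids m (x + (fst z, 0)) - pyramids m x\<bar> \<le> slope m k * ?d"
      using pyramids_diff_le_slope[of x k "x + (fst z, 0)" m] k le_d(1) slope_pos[of m k]
      by (smt (verit) add.right_neutral mult_left_mono snd_add snd_conv)
    moreover have "\<bar>pyramids m (x + (0, snd z)) - pyramids m x\<bar> \<le> slope m k * ?d"
      using pyramids_diff_le_slope[of x k "x + (0, snd z)" m] k le_d(2) slope_pos[of m k]
      by (smt (verit) add.right_neutral mult_left_mono fst_add fst_conv)
    ultimately have "diff_quotient m \<theta>\<^sub>1 \<theta>\<^sub>2 z x \<le> slope m k powr (\<theta>\<^sub>1 + \<theta>\<^sub>2) / ?d"
      unfolding diff_quotient_def using assms z slope_pos by (intro powr_quotient_le) auto
    then have "ennreal (diff_quotient m \<theta>\<^sub>1 \<theta>\<^sub>2 z x) \<le> ennreal (slope m k powr (\<theta>\<^sub>1 + \<theta>\<^sub>2) / ?d) * indicator (near_crease m k ?d) x"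
      using 1 by (simp add: ennreal_leI)
    also have "\<dots> \<le> (\<Sum>k. ennreal (slope m k powr (\<theta>\<^sub>1 + \<theta>\<^sub>2) / ?d) * indicator (near_crease m k ?d) x)"
    proof -
      have "f k \<le> suminf f" for f :: "nat \<Rightarrow> ennreal"
        using sum_le_suminf[of f "{k}"] by simp
      then show ?thesis .
    qed
    finally show ?thesis by (rule order.trans) simp
  next
    case (2 i j)
    have pos: "fst x > 0" "snd x > 0" "fst x \<le> 2" "snd x \<le> 2"
      using 2 strip_pos strip_le by auto
    have "diff_quotient m \<theta>\<^sub>1 \<theta>\<^sub>2 z x \<le> 1 powr (\<theta>\<^sub>1 + \<theta>\<^sub>2) / ?d"
      unfolding diff_quotient_def using assms z le_d pyramids_lip[of m "x + (fst z, 0)" x] pyramids_lip[of m "x + (0, snd z)" x]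
      by (intro powr_quotient_le) (auto intro: order.trans)
    \<comment> \<open>split \<open>1 / norm z\<close> evenly between the two coordinates, both of which are at most \<open>6 * norm z\<close>\<close>
    also have "\<dots> = 6 * ((6 * ?d) powr (-1/2) * (6 * ?d) powr (-1/2))"
      using z by (simp add: powr_minus_divide flip: powr_add)
    also have "\<dots> \<le> 6 * (fst x powr (-1/2) * snd x powr (-1/2))"
      using 2 pos z by (intro mult_left_mono mult_mono powr_mono2') auto
    finally have "ennreal (diff_quotient m \<theta>\<^sub>1 \<theta>\<^sub>2 z x) \<le> ennreal (6 * (fst x powr (-1/2) * snd x powr (-1/2)))"
      by (rule ennreal_leI)
    also have "\<dots> = 6 * (inv_sqrt (fst x) * inv_sqrt (snd x))"
      using pos by (simp add: inv_sqrt_def ennreal_mult)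
    finally show ?thesis by (rule order.trans) simp
  qed
qed

lemma slope_powr:
  assumes "real m * (\<theta> - 1) \<ge> 1"
  shows "slope m k powr \<theta> \<le> slope m k * (1/2) ^ k"
proof -
  have "slope m k powr \<theta> = slope m k powr (1 + (\<theta> - 1))" by simp
  also have "\<dots> = slope m k * slope m k powr (\<theta> - 1)"
    using slope_pos[of m k] by (simp only: powr_add powr_one)
  also have "slope m k powr (\<theta> - 1) = ((1/2) powr real (m * k)) powr (\<theta> - 1)"
    by (subst powr_realpow) (auto simp: slope_def)
  also have "\<dots> = (1/2) powr (real k * (real m * (\<theta> - 1)))"
    by (simp add: powr_powr mult_ac)
  also have "\<dots> \<le> (1/2) powr (real k * 1)"
    using assms by (intro powr_mono' mult_left_mono) auto
  also have "\<dots> = (1/2) ^ k" by (simp add: powr_realpow)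
  finally show ?thesis using slope_pos[of m k] by simp
qed

text \<open>The inner integral is bounded uniformly in \<open>z\<close>: the set near the creases of block \<open>k\<close> has measure
  \<open>O(cells m k * left_end k * norm z)\<close>, so that the powers of \<open>norm z\<close> cancel and a convergent
  geometric series remains. The interaction of different blocks contributes the integral of a fixed function.\<close>

lemma inner_integral_bound:
  assumes "real m * (\<theta>\<^sub>1 + \<theta>\<^sub>2 - 1) \<ge> 1" "\<theta>\<^sub>1 > 0" "\<theta>\<^sub>2 > 0"
  obtains C :: ennreal where "C < \<infinity>" "\<And>z. (\<integral>\<^sup>+x. ennreal (diff_quotient m \<theta>\<^sub>1 \<theta>\<^sub>2 z x) \<partial>lebesgue) \<le> C"
proof -
  let ?W = "\<integral>\<^sup>+x. inv_sqrt (fst x) * inv_sqrt (snd x) \<partial>lborel"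
  have [measurable]: "(\<lambda>x::plane. inv_sqrt (fst x)) \<in> borel_measurable borel"
    "(\<lambda>x::plane. inv_sqrt (snd x)) \<in> borel_measurable borel"
    by (simp_all add: borel_prod[symmetric])
  define C where "C = ennreal 8 + 6 * ?W"
  have "(\<integral>\<^sup>+x. ennreal (diff_quotient m \<theta>\<^sub>1 \<theta>\<^sub>2 z x) \<partial>lebesgue) \<le> C" for z
  proof (cases "z = 0")
    case True
    \<comment> \<open>division by zero yields zero\<close>
    then show ?thesis by (simp add: diff_quotient_def)
  next
    case False
    let ?d = "norm z"
    have "(\<integral>\<^sup>+x. ennreal (diff_quotient m \<theta>\<^sub>1 \<theta>\<^sub>2 z x) \<partial>lebesgue) \<le>
       (\<integral>\<^sup>+x. (\<Sum>k. ennreal (slope m k powr (\<theta>\<^sub>1 + \<theta>\<^sub>2) / ?d) * indicator (near_crease m k ?d) x)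
     + 6 * (inv_sqrt (fst x) * inv_sqrt (snd x)) \<partial>lborel)"
      unfolding nn_integral_completion by (intro nn_integral_mono diff_quotient_le_sum assms False)
    also have "\<dots> = (\<Sum>k. \<integral>\<^sup>+x. ennreal (slope m k powr (\<theta>\<^sub>1 + \<theta>\<^sub>2) / ?d) * indicator (near_crease m k ?d) x \<partial>lborel) + 6 * ?W"
      by (simp add: nn_integral_add nn_integral_suminf nn_integral_cmult)
    also have "(\<Sum>k. \<integral>\<^sup>+x. ennreal (slope m k powr (\<theta>\<^sub>1 + \<theta>\<^sub>2) / ?d) * indicator (near_crease m k ?d) x \<partial>lborel)
        \<le> (\<Sum>k. ennreal (4 * (1/2) ^ k))"
    proof (intro suminf_le)
      fix k
      have "(\<integral>\<^sup>+x. ennreal (slope m k powr (\<theta>\<^sub>1 + \<theta>\<^sub>2) / ?d) * indicator (near_crease m k ?d) x \<partial>lborel) =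
         ennreal (slope m k powr (\<theta>\<^sub>1 + \<theta>\<^sub>2) / ?d) * emeasure lborel (near_crease m k ?d)"
        by (rule nn_integral_cmult_indicator) simp
      also have "\<dots> \<le> ennreal (slope m k powr (\<theta>\<^sub>1 + \<theta>\<^sub>2) / ?d) * ennreal (4 * real (cells m k) * left_end k * ?d)"
        by (intro mult_left_mono emeasure_near_crease) auto
      also have "\<dots> = ennreal (4 * (real (cells m k) * left_end k) * slope m k powr (\<theta>\<^sub>1 + \<theta>\<^sub>2))"
        using False left_end_pos[of k] by (simp add: mult_ac flip: ennreal_mult)
      also have "\<dots> \<le> ennreal (4 * (real (cells m k) * left_end k) * (slope m k * (1/2) ^ k))"
        using slope_powr[OF assms(1), of k] left_end_pos[of k] by (intro ennreal_leI mult_left_mono) auto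
      also have "4 * (real (cells m k) * left_end k) * (slope m k * (1/2) ^ k) = 4 * (1/2) ^ k"
        using cells_left_end_slope[of m k] by (simp add: mult.assoc)
      finally show "(\<integral>\<^sup>+x. ennreal (slope m k powr (\<theta>\<^sub>1 + \<theta>\<^sub>2) / ?d) * indicator (near_crease m k ?d) x \<partial>lborel) \<le> ennreal (4 * (1/2) ^ k)" .
    qed auto
    also have "(\<Sum>k. ennreal (4 * (1/2) ^ k)) = ennreal 8"
    proof (rule suminf_ennreal_eq)
      show "(\<lambda>k. 4 * (1/2) ^ k) sums (8::real)"
        using sums_mult[OF geometric_sums[of "1/2::real"], of 4] by simp
    qed auto
    finally show ?thesis by (simp add: C_def)
  qed
  moreover have "C < \<infinity>" using nn_integral_inv_sqrt_prod by (simp add: C_def ennreal_mult_less_top)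
  ultimately show thesis using that by blast
qed

text \<open>Rescaling preserves the mass of the kernel.\<close>

lemma nn_integral_rescaled:
  assumes \<rho>: "integrable lebesgue \<rho>" and "\<epsilon> > 0"
  shows "(\<lambda>z. ennreal (rescaled \<rho> \<epsilon> z)) \<in> borel_measurable lebesgue"
    and "(\<integral>\<^sup>+z. ennreal (rescaled \<rho> \<epsilon> z) \<partial>lebesgue) = (\<integral>\<^sup>+z. ennreal (\<rho> z) \<partial>lebesgue)"
proof -
  let ?T = "\<lambda>z::plane. (0::plane) + (\<Sum>j\<in>Basis. (inverse \<epsilon> * (z \<bullet> j)) *\<^sub>R j)"
  have T: "?T z = z /\<^sub>R \<epsilon>" for z
    by (subst euclidean_representation[of z, symmetric]) (simp only: scaleR_sum_right scaleR_scaleR add_0)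
  have Tm: "?T \<in> lebesgue \<rightarrow>\<^sub>M lebesgue"
    using lebesgue_affine_measurable[of "\<lambda>_. inverse \<epsilon>" 0] assms by simp
  have \<rho>m: "\<rho> \<in> borel_measurable lebesgue" using \<rho> by auto
  then have \<rho>Tm: "(\<lambda>z. \<rho> (?T z)) \<in> borel_measurable lebesgue" using Tm by (rule measurable_compose[rotated])
  then show "(\<lambda>z. ennreal (rescaled \<rho> \<epsilon> z)) \<in> borel_measurable lebesgue"
    unfolding rescaled_def T by measurable
  have "lebesgue = density (distr lebesgue lebesgue ?T) (\<lambda>_. (\<Prod>j\<in>(Basis::plane set). \<bar>inverse \<epsilon>\<bar>))"
    using assms by (intro lebesgue_affine_euclidean) auto
  then have "(\<integral>\<^sup>+z. ennreal (\<rho> z) \<partial>lebesgue) = (\<integral>\<^sup>+z. ennreal (\<rho> z) \<partial>density (distr lebesgue lebesgue ?T) (\<lambda>_. (\<Prod>j\<in>(Basis::plane set). \<bar>inverse \<epsilon>\<bar>)))"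
    by simp
  also have "\<dots> = (\<integral>\<^sup>+z. ennreal (inverse \<epsilon> ^ 2) * ennreal (\<rho> (?T z)) \<partial>lebesgue)"
    using Tm \<rho>m assms by (subst nn_integral_density) (auto simp: nn_integral_distr power2_eq_square)
  also have "\<dots> = (\<integral>\<^sup>+z. ennreal (rescaled \<rho> \<epsilon> z) \<partial>lebesgue)"
    unfolding T using assms by (simp add: rescaled_def divide_inverse power_inverse mult.commute flip: ennreal_mult'')
  finally show "(\<integral>\<^sup>+z. ennreal (rescaled \<rho> \<epsilon> z) \<partial>lebesgue) = (\<integral>\<^sup>+z. ennreal (\<rho> z) \<partial>lebesgue)" ..
qed

lemma energy_pyramids_finite:
  assumes "radial_kernel \<rho>" "real m * (\<theta>\<^sub>1 + \<theta>\<^sub>2 - 1) \<ge> 1" "\<theta>\<^sub>1 > 0" "\<theta>\<^sub>2 > 0"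
  shows "energy \<rho> (1 + (\<theta>\<^sub>1 + \<theta>\<^sub>2)) \<theta>\<^sub>1 \<theta>\<^sub>2 (pyramids m) < \<infinity>"
proof -
  obtain C where C: "C < \<infinity>" "\<And>z. (\<integral>\<^sup>+x. ennreal (diff_quotient m \<theta>\<^sub>1 \<theta>\<^sub>2 z x) \<partial>lebesgue) \<le> C"
    using inner_integral_bound[OF assms(2-4)] by blast
  have \<rho>: "integrable lebesgue \<rho>" using assms(1) by (simp add: radial_kernel_def)
  have "energy_eps \<rho> \<epsilon> (1 + (\<theta>\<^sub>1 + \<theta>\<^sub>2)) \<theta>\<^sub>1 \<theta>\<^sub>2 (pyramids m) \<le> (\<integral>\<^sup>+z. ennreal (\<rho> z) \<partial>lebesgue) * C" if "\<epsilon> > 0" for \<epsilon>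
  proof -
    have "energy_eps \<rho> \<epsilon> (1 + (\<theta>\<^sub>1 + \<theta>\<^sub>2)) \<theta>\<^sub>1 \<theta>\<^sub>2 (pyramids m) \<le> (\<integral>\<^sup>+z. ennreal (rescaled \<rho> \<epsilon> z) * C \<partial>lebesgue)"
      unfolding energy_eps_def by (intro nn_integral_mono mult_left_mono C(2)[unfolded diff_quotient_def]) auto
    also have "\<dots> = (\<integral>\<^sup>+z. ennreal (rescaled \<rho> \<epsilon> z) \<partial>lebesgue) * C"
      by (rule nn_integral_multc) (rule nn_integral_rescaled(1)[OF \<rho> that])
    finally show ?thesis by (simp only: nn_integral_rescaled(2)[OF \<rho> that])
  qed
  then have "energy \<rho> (1 + (\<theta>\<^sub>1 + \<theta>\<^sub>2)) \<theta>\<^sub>1 \<theta>\<^sub>2 (pyramids m) \<le> (\<integral>\<^sup>+z. ennreal (\<rho> z) \<partial>lebesgue) * C"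
    unfolding energy_def
    by (intro Liminf_le) (auto simp: eventually_at_filter)
  also have "\<dots> < \<infinity>"
    using C(1) integrableD(2)[OF \<rho>] assms(1) by (simp add: ennreal_mult_less_top radial_kernel_def less_top)
  finally show ?thesis .
qed

section \<open>The mixed derivative has infinite mass\<close>

lemma bump_continuous: "continuous_on A bump" and bump'_continuous: "continuous_on A bump'"
  using DERIV_isCont[OF bump_deriv] bump'_differentiable DERIV_isCont
  by (metis continuous_at_imp_continuous_on)+

lemma lborel_integral_eqI:
  fixes f :: "real \<Rightarrow> real"
  assumes "integrable lborel f" "\<And>t. t \<notin> {0..1} \<Longrightarrow> f t = 0" "(f has_integral V) {0..1}"
  shows "integral\<^sup>L lborel f = V"
proof -
  have "(f has_integral V) UNIV"
    using assms(2) by (rule has_integral_on_superset[OF assms(3)]) auto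
  with has_integral_integral_lborel[OF assms(1)] show ?thesis by (rule has_integral_unique)
qed

text \<open>An antiderivative of \<^const>\<open>bump\<close> on \<open>[0, 1]\<close>.\<close>

definition bump_int :: "real \<Rightarrow> real" where "bump_int t = integral {0..t} bump"

lemma bump_int_deriv:
  "t \<in> {0..1} \<Longrightarrow> (bump_int has_real_derivative bump t) (at t within {0..1})"
  unfolding bump_int_def has_real_derivative_iff_has_vector_derivative
  by (intro integral_has_vector_derivative bump_continuous)

text \<open>Integration by parts on both sides of the kink at \<open>y = x\<close>.\<close>

lemma corner_inner_integral:
  assumes "x \<in> {0..1}"
  shows "((\<lambda>y. min (1 - x) (1 - y) * bump' y) has_integral (bump_int 1 - bump_int x)) {0..1}"
proof -
  have bump: "(bump has_real_derivative bump' y) (at y within S)" for y S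
    using bump_deriv by (rule has_field_derivative_at_within)
  have "((\<lambda>y. (1 - x) * bump' y) has_integral (1 - x) * bump x - (1 - x) * bump 0) {0..x}"
    using assms
    by (intro fundamental_theorem_of_calculus)
       (auto simp flip: has_real_derivative_iff_has_vector_derivative intro!: derivative_eq_intros bump)
  then have 1: "((\<lambda>y. min (1 - x) (1 - y) * bump' y) has_integral (1 - x) * bump x) {0..x}"
    using bump_eq_0[of 0] by (subst has_integral_cong[where g = "\<lambda>y. (1 - x) * bump' y"]) (auto simp: min_def)
  have "((\<lambda>y. (1 - y) * bump' y) has_integral
      ((1 - 1) * bump 1 + bump_int 1) - ((1 - x) * bump x + bump_int x)) {x..1}"
    using assms
    by (intro fundamental_theorem_of_calculus)
       (auto simp flip: has_real_derivative_iff_has_vector_derivative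
         intro!: derivative_eq_intros bump DERIV_subset[OF bump_int_deriv, where t = "{x..1}"])
  then have 2: "((\<lambda>y. min (1 - x) (1 - y) * bump' y) has_integral bump_int 1 - ((1 - x) * bump x + bump_int x)) {x..1}"
    by (subst has_integral_cong[where g = "\<lambda>y. (1 - y) * bump' y"]) (auto simp: min_def)
  have "((\<lambda>y. min (1 - x) (1 - y) * bump' y) has_integral (1 - x) * bump x + (bump_int 1 - ((1 - x) * bump x + bump_int x))) {0..1}"
    using assms by (intro has_integral_combine[OF _ _ 1 2]) auto
  then show ?thesis by simp
qed

text \<open>The mixed derivative of \<open>min (1 - x) (1 - y)\<close> tested against the product bump on the unit square. This mixed
  derivative is the length measure (with respect to \<open>x\<close>) of the diagonal, which explains \<open>corner_const_eq\<close> below.\<close>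

definition corner_const :: real where
  "corner_const = (\<integral>x. min (1 - fst x) (1 - snd x) * (bump' (fst x) * bump' (snd x)) \<partial>lborel)"

lemma corner_integrable:
  "integrable lborel (\<lambda>x. min (1 - fst x) (1 - snd x) * (bump' (fst x) * bump' (snd x)))"
proof -
  have "integrable lborel (\<lambda>x. indicator (cbox (0,0) (1,1)) x *\<^sub>R (min (1 - fst x) (1 - snd x) * (bump' (fst x) * bump' (snd x))))"
    by (intro borel_integrable_compact compact_cbox continuous_intros
        continuous_on_compose2[OF bump'_continuous[of UNIV]]) auto
  also have "(\<lambda>x. indicator (cbox (0,0) (1,1)) x *\<^sub>R (min (1 - fst x) (1 - snd x) * (bump' (fst x) * bump' (snd x)))) =
    (\<lambda>x. min (1 - fst x) (1 - snd x) * (bump' (fst x) * bump' (snd x)))"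
  proof
    fix x :: plane
    show "indicator (cbox (0,0) (1,1)) x *\<^sub>R (min (1 - fst x) (1 - snd x) * (bump' (fst x) * bump' (snd x))) =
      min (1 - fst x) (1 - snd x) * (bump' (fst x) * bump' (snd x))"
    proof (cases "fst x \<in> {0<..<1} \<and> snd x \<in> {0<..<1}")
      case True
      then have "x \<in> cbox (0,0) (1,1)" by (cases x) (auto simp: cbox_Pair_eq)
      then show ?thesis by simp
    next
      case False
      then have "bump' (fst x) * bump' (snd x) = 0" using bump'_eq_0 by auto
      then show ?thesis by simp
    qed
  qed
  finally show ?thesis .
qed

lemma corner_const_eq: "corner_const = integral {0..1} (\<lambda>t. bump t ^ 2)"
proof -
  let ?f = "\<lambda>x y. min (1 - x) (1 - y) * (bump' x * bump' y)"
  have int: "integrable (lborel \<Otimes>\<^sub>M lborel) (\<lambda>(x, y). ?f x y)"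
    using corner_integrable by (simp only: lborel_prod case_prod_unfold)
  have inner: "(\<integral>y. ?f x y \<partial>lborel) = bump' x * (bump_int 1 - bump_int x)" for x
  proof (cases "x \<in> {0..1}")
    case True
    have "integrable lborel (\<lambda>y. indicator {0..1} y *\<^sub>R ?f x y)"
      by (intro borel_integrable_compact compact_Icc continuous_intros bump'_continuous)
    moreover have "indicator {0..1} y *\<^sub>R ?f x y = ?f x y" for y
      by (cases "y \<in> {0<..<1}") (auto simp: bump'_eq_0)
    ultimately have "integrable lborel (?f x)" by (simp only:)
    then show ?thesis
    proof (rule lborel_integral_eqI)
      show "(?f x has_integral bump' x * (bump_int 1 - bump_int x)) {0..1}"
        using has_integral_mult_right[OF corner_inner_integral[OF True], of "bump' x"] by (simp add: mult_ac)
    qed (auto simp: bump'_eq_0)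
  next
    case False
    then have "bump' x = 0" by (intro bump'_eq_0) auto
    then show ?thesis by simp
  qed
  have "corner_const = (\<integral>x. (\<integral>y. ?f x y \<partial>lborel) \<partial>lborel)"
    using lborel_pair.integral_fst'[OF int] unfolding corner_const_def
    by (simp only: lborel_prod case_prod_unfold fst_conv snd_conv)
  also have "\<dots> = (\<integral>x. bump' x * (bump_int 1 - bump_int x) \<partial>lborel)"
    by (simp only: inner)
  also have "\<dots> = integral {0..1} (\<lambda>t. bump t ^ 2)"
  proof (rule lborel_integral_eqI)
    show "integrable lborel (\<lambda>x. bump' x * (bump_int 1 - bump_int x))"
      using lborel_pair.integrable_fst'[OF int] by (simp add: inner)
    \<comment> \<open>integration by parts: this is the derivative of \<open>bump x * (bump_int 1 - bump_int x)\<close>\<close>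
    have "((\<lambda>x. bump' x * (bump_int 1 - bump_int x) - bump x ^ 2) has_integral
        bump 1 * (bump_int 1 - bump_int 1) - bump 0 * (bump_int 1 - bump_int 0)) {0..1}"
      by (intro fundamental_theorem_of_calculus)
         (auto simp: power2_eq_square simp flip: has_real_derivative_iff_has_vector_derivative
           intro!: derivative_eq_intros has_field_derivative_at_within[OF bump_deriv] bump_int_deriv)
    moreover have "((\<lambda>t. bump t ^ 2) has_integral integral {0..1} (\<lambda>t. bump t ^ 2)) {0..1}"
      by (intro integrable_integral integrable_continuous_interval continuous_intros bump_continuous)
    ultimately have "((\<lambda>x. bump' x * (bump_int 1 - bump_int x) - bump x ^ 2 + bump x ^ 2) has_integral
        bump 1 * (bump_int 1 - bump_int 1) - bump 0 * (bump_int 1 - bump_int 0) + integral {0..1} (\<lambda>t. bump t ^ 2)) {0..1}"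
      by (rule has_integral_add)
    then show "((\<lambda>x. bump' x * (bump_int 1 - bump_int x)) has_integral integral {0..1} (\<lambda>t. bump t ^ 2)) {0..1}"
      using bump_eq_0[of 0] by simp
  qed (auto simp: bump'_eq_0)
  finally show ?thesis .
qed

lemma corner_const_pos: "corner_const > 0"
proof -
  have "continuous_on {0..1} (\<lambda>t. bump t ^ 2)" by (intro continuous_intros bump_continuous)
  moreover have "bump (1/2) \<noteq> 0" by (simp add: bump_def flat_exp_def)
  ultimately have "integral {0..1} (\<lambda>t. bump t ^ 2) \<noteq> 0"
    by (subst integral_eq_0_iff) (auto intro!: bexI[of _ "1/2"])
  moreover have "integral {0..1} (\<lambda>t. bump t ^ 2) \<ge> 0"
    by (rule integral_nonneg) (auto intro!: integrable_continuous_interval continuous_intros bump_continuous)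
  ultimately show ?thesis by (simp add: corner_const_eq)
qed

text \<open>The upper right quarters of the cells are considered, where \<^const>\<open>pyramids\<close> is a scaled copy of
  \<open>min (1 - x) (1 - y)\<close>. Their lower left corners are the centres of the cells, with coordinates \<open>quarter_corner\<close>.\<close>

definition quarter_corner :: "nat \<Rightarrow> nat \<Rightarrow> nat \<Rightarrow> real" where
  "quarter_corner m k i = left_end k + (real i + 1/2) * cell_width m k"

lemma bwave_quarter:
  assumes "i < cells m k" "t \<in> {0..1}"
  shows "quarter_corner m k i + cell_width m k / 2 * t \<in> strip k"
    and "bwave m k (quarter_corner m k i + cell_width m k / 2 * t) = cell_width m k / 2 * (1 - t)"
proof -
  let ?l = "cell_width m k" and ?s = "quarter_corner m k i + cell_width m k / 2 * t"
  have l: "?l > 0" by (rule cell_width_pos)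
  have t: "0 \<le> ?l * t" "?l * t \<le> ?l" using l assms mult_left_le[of t ?l] by auto
  have i: "(real i + 1) * ?l \<le> real (cells m k) * ?l" "0 \<le> real i * ?l"
    using assms l by (auto intro!: mult_right_mono)
  then have s: "?s \<in> {left_end k..left_end k + real (cells m k) * ?l}"
  proof -
    have "?s = left_end k + real i * ?l + ?l / 2 + ?l * t / 2" "(real i + 1) * ?l = real i * ?l + ?l"
      by (simp_all add: quarter_corner_def algebra_simps)
    with t i show ?thesis unfolding atLeastAtMost_iff by linarith
  qed
  then show "?s \<in> strip k" by (simp only: strip_eq[of k m])
  have "?s - (left_end k + real (i + 1) * ?l) = - (?l / 2 * (1 - t))"
    by (simp add: quarter_corner_def field_simps)
  moreover have "0 \<le> ?l / 2 * (1 - t)" "?l / 2 * (1 - t) \<le> ?l / 2" using t by (simp_all add: algebra_simps)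
  ultimately show "bwave m k ?s = ?l / 2 * (1 - t)"
    unfolding bwave_def using wave_near_grid[OF l s, of "i + 1"] by simp
qed

lemma lborel_integral_plane_affine:
  fixes f :: "plane \<Rightarrow> real"
  assumes "f \<in> borel_measurable borel" "h > 0"
  shows "(\<integral>x. f x \<partial>lborel) = (\<integral>x. h ^ 2 * f (p + h *\<^sub>R x) \<partial>lborel)"
proof -
  have "(\<integral>x. f x \<partial>lborel) =
      (\<integral>x. f x \<partial>density (distr lborel borel (\<lambda>x. p + h *\<^sub>R x)) (\<lambda>_. ennreal (h ^ 2)))"
    using lborel_affine[of h p] assms(2) by (simp add: power2_eq_square)
  also have "\<dots> = (\<integral>x. h ^ 2 * f (p + h *\<^sub>R x) \<partial>lborel)"
    using assms by (subst integral_density) (auto simp: integral_distr)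
  finally show ?thesis .
qed

lemma mixed_derivative_pyramids:
  assumes "i < cells m k" "j < cells m k"
  shows "mixed_derivative (pyramids m) (tensor_bump (cell_width m k / 2) (quarter_corner m k i, quarter_corner m k j))
    = slope m k * (cell_width m k / 2) * corner_const"
proof -
  let ?h = "cell_width m k / 2" and ?p = "(quarter_corner m k i, quarter_corner m k j)"
  have h: "?h > 0" using cell_width_pos[of m k] by simp
  let ?g = "\<lambda>x. pyramids m x * (bump' ((fst x - fst ?p) / ?h) / ?h * (bump' ((snd x - snd ?p) / ?h) / ?h))"
  have "continuous_on UNIV ?g"
    using h by (intro continuous_intros continuous_on_compose2[OF bump'_continuous[of UNIV]]
        lipschitz_on_continuous_on[OF pyramids_lipschitz]) auto
  then have g: "?g \<in> borel_measurable borel" by (rule borel_measurable_continuous_onI)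
  have "mixed_derivative (pyramids m) (tensor_bump ?h ?p) = (\<integral>x. ?g x \<partial>lebesgue)"
    by (rule mixed_derivative_tensor_bump[OF h])
  also have "\<dots> = (\<integral>x. ?g x \<partial>lborel)" using g by (intro integral_completion) simp
  also have "\<dots> = (\<integral>x. ?h ^ 2 * ?g (?p + ?h *\<^sub>R x) \<partial>lborel)"
    by (rule lborel_integral_plane_affine[OF g h])
  also have "(\<lambda>x. ?h ^ 2 * ?g (?p + ?h *\<^sub>R x)) =
     (\<lambda>x. slope m k * ?h * (min (1 - fst x) (1 - snd x) * (bump' (fst x) * bump' (snd x))))"
  proof
    fix x
    have eq: "?h ^ 2 * ?g (?p + ?h *\<^sub>R x) = pyramids m (?p + ?h *\<^sub>R x) * (bump' (fst x) * bump' (snd x))"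
      using h by (simp add: power2_eq_square)
    show "?h ^ 2 * ?g (?p + ?h *\<^sub>R x) =
       slope m k * ?h * (min (1 - fst x) (1 - snd x) * (bump' (fst x) * bump' (snd x)))"
    proof (cases "fst x \<in> {0<..<1} \<and> snd x \<in> {0<..<1}")
      case True
      then have x: "fst x \<in> {0..1}" "snd x \<in> {0..1}" by auto
      have "pyramids m (?p + ?h *\<^sub>R x) = block m k (?p + ?h *\<^sub>R x)"
        using bwave_quarter(1)[OF assms(1) x(1)] by (intro pyramids_eq_block) simp
      also have "\<dots> = slope m k * min (?h * (1 - fst x)) (?h * (1 - snd x))"
      proof -
        have "bwave m k (fst (?p + ?h *\<^sub>R x)) = ?h * (1 - fst x)"
          "bwave m k (snd (?p + ?h *\<^sub>R x)) = ?h * (1 - snd x)"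
          using bwave_quarter(2)[OF assms(1) x(1)] bwave_quarter(2)[OF assms(2) x(2)] by simp_all
        then show ?thesis by (simp only: block_def)
      qed
      also have "min (?h * (1 - fst x)) (?h * (1 - snd x)) = ?h * min (1 - fst x) (1 - snd x)"
        using h by (simp add: min_mult_distrib_left)
      finally show ?thesis unfolding eq by simp
    next
      case False
      then have "bump' (fst x) * bump' (snd x) = 0" using bump'_eq_0 by auto
      then show ?thesis unfolding eq by (simp only: mult_zero_right)
    qed
  qed
  also have "(\<integral>x. slope m k * ?h * (min (1 - fst x) (1 - snd x) * (bump' (fst x) * bump' (snd x))) \<partial>lborel) = slope m k * ?h * corner_const"
    unfolding corner_const_def by (rule integral_mult_right_zero)
  finally show ?thesis .
qed

text \<open>The open upper right quarter of the cell in column \<open>i\<close> and row \<open>j\<close> of block \<open>k\<close>.\<close>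

definition quarter_cell :: "nat \<Rightarrow> nat \<times> nat \<times> nat \<Rightarrow> plane set" where
  "quarter_cell m = (\<lambda>(k, i, j). box (quarter_corner m k i, quarter_corner m k j)
     ((quarter_corner m k i, quarter_corner m k j) + (cell_width m k / 2, cell_width m k / 2)))"

text \<open>The integral with respect to \<open>N\<close> can be dropped because the bump is nonnegative.\<close>

lemma measure_quarter_cell:
  assumes M: "finite_radon_measure M"
    and eq: "\<And>\<phi>. test_function \<phi> \<Longrightarrow> mixed_derivative (pyramids m) \<phi> = integral\<^sup>L M \<phi> - integral\<^sup>L N \<phi>"
    and "i < cells m k" "j < cells m k"
  shows "slope m k * (cell_width m k / 2) * corner_const \<le> measure M (quarter_cell m (k, i, j))"
proof -
  let ?h = "cell_width m k / 2" and ?p = "(quarter_corner m k i, quarter_corner m k j)"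
  let ?\<phi> = "tensor_bump ?h ?p"
  have h: "?h > 0" using cell_width_pos[of m k] by simp
  have sets: "sets M = sets borel" and "finite_measure M" using M by (auto simp: finite_radon_measure_def)
  then interpret M: finite_measure M by simp
  have nonneg: "0 \<le> ?\<phi> x" for x by (simp add: tensor_bump_def bump_nonneg)
  have le: "?\<phi> x \<le> indicator (quarter_cell m (k, i, j)) x" for x
  proof (cases "x \<in> quarter_cell m (k, i, j)")
    case False
    then show ?thesis using tensor_bump_eq_0[OF h, of x ?p] by (simp add: quarter_cell_def)
  qed (simp add: tensor_bump_def mult_le_one bump_nonneg bump_le_1)
  have Q: "quarter_cell m (k, i, j) \<in> sets M" by (simp add: sets quarter_cell_def)
  have "slope m k * ?h * corner_const = integral\<^sup>L M ?\<phi> - integral\<^sup>L N ?\<phi>"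
    using mixed_derivative_pyramids[OF assms(3,4)] eq[OF tensor_bump_test[OF h]] by simp
  also have "\<dots> \<le> integral\<^sup>L M ?\<phi>" using nonneg by (simp add: integral_nonneg)
  also have "\<dots> \<le> integral\<^sup>L M (indicator (quarter_cell m (k, i, j)))"
  proof (rule integral_mono')
    show "integrable M (indicator (quarter_cell m (k, i, j)) :: plane \<Rightarrow> real)"
      using Q by (intro integrable_real_indicator) (simp_all add: M.emeasure_finite less_top[symmetric])
  qed (auto intro: le nonneg)
  also have "\<dots> = measure M (quarter_cell m (k, i, j))"
    using Q sets.sets_into_space[OF Q] by (simp add: Int_absorb1)
  finally show ?thesis .
qed

lemma quarter_interval_unique:
  assumes "t \<in> {quarter_corner m k i<..<quarter_corner m k i + cell_width m k / 2}"
    "t \<in> {quarter_corner m k i'<..<quarter_corner m k i' + cell_width m k / 2}"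
  shows "i = i'"
proof -
  have "\<not> i < i'" if "t < quarter_corner m k i + cell_width m k / 2" "quarter_corner m k i' < t" for i i'
  proof
    assume "i < i'"
    then have "(real i + 1) * cell_width m k \<le> real i' * cell_width m k"
      using cell_width_pos[of m k] by (intro mult_right_mono) auto
    with that cell_width_pos[of m k] show False by (simp add: quarter_corner_def algebra_simps)
  qed
  from this[of i i'] this[of i' i] assms show ?thesis by force
qed

lemma quarter_cells_disjoint:
  "disjoint_family_on (quarter_cell m) (SIGMA k:UNIV. {..<cells m k} \<times> {..<cells m k})"
  unfolding disjoint_family_on_def
proof (intro ballI impI equals0I)
  fix c c' x
  assume mem: "c \<in> (SIGMA k:UNIV. {..<cells m k} \<times> {..<cells m k})"
    "c' \<in> (SIGMA k:UNIV. {..<cells m k} \<times> {..<cells m k})"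
    and ne: "c \<noteq> c'" and inter: "x \<in> quarter_cell m c \<inter> quarter_cell m c'"
  obtain k i j k' i' j' x1 x2 where c: "c = (k, i, j)" "c' = (k', i', j')" and x_eq: "x = (x1, x2)"
    by (metis prod_cases3 surj_pair)
  have ij: "i < cells m k" "i' < cells m k'"
    and x: "(x1, x2) \<in> quarter_cell m (k, i, j)" "(x1, x2) \<in> quarter_cell m (k', i', j')"
    using mem inter by (simp_all add: c x_eq)
  have box: "x1 \<in> {quarter_corner m k i<..<quarter_corner m k i + cell_width m k / 2}
      \<and> x2 \<in> {quarter_corner m k j<..<quarter_corner m k j + cell_width m k / 2}"
    if "(x1, x2) \<in> quarter_cell m (k, i, j)" for k i j
    using that by (auto simp: quarter_cell_def box_def Basis_prod_def)
  have strip: "x1 \<in> strip k" if "(x1, x2) \<in> quarter_cell m (k, i, j)" "i < cells m k" for k i j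
  proof -
    let ?t = "(x1 - quarter_corner m k i) / (cell_width m k / 2)"
    have "?t \<in> {0..1}" using box[OF that(1)] cell_width_pos[of m k] by (simp add: field_simps)
    moreover have "cell_width m k / 2 * ?t = x1 - quarter_corner m k i"
      using cell_width_pos[of m k] by simp
    ultimately show ?thesis using bwave_quarter(1)[OF that(2), of ?t] by simp
  qed
  have "k = k'" using strip[OF x(1) ij(1)] strip[OF x(2) ij(2)] by (rule strip_unique)
  with box[OF x(1)] box[OF x(2)] quarter_interval_unique[of x1 m k i i'] quarter_interval_unique[of x2 m k j j'] ne c
  show False by auto
qed

text \<open>By \<open>measure_quarter_cell\<close> every block contributes at least \<open>corner_const / 4\<close> to the total mass of \<open>M\<close>.\<close>

lemma pyramids_not_measure: "\<not> is_finite_radon_measure (mixed_derivative (pyramids m))"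
proof
  assume "is_finite_radon_measure (mixed_derivative (pyramids m))"
  then obtain M N where M: "finite_radon_measure M"
    and eq: "\<And>\<phi>. test_function \<phi> \<Longrightarrow> mixed_derivative (pyramids m) \<phi> = integral\<^sup>L M \<phi> - integral\<^sup>L N \<phi>"
    unfolding is_finite_radon_measure_def by blast
  have sets: "sets M = sets borel" and "finite_measure M" using M by (auto simp: finite_radon_measure_def)
  then interpret M: finite_measure M by simp
  have le: "real K * (corner_const / 4) \<le> measure M (space M)" for K
  proof -
    let ?I = "SIGMA k:{..<K}. {..<cells m k} \<times> {..<cells m k}"
    have "real K * (corner_const / 4) = (\<Sum>k<K. corner_const / 4)" by simp
    also have "\<dots> = (\<Sum>k<K. \<Sum>ij\<in>{..<cells m k} \<times> {..<cells m k}. slope m k * (cell_width m k / 2) * corner_const)"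
    proof (rule sum.cong)
      fix k
      have "real (cells m k) * (real (cells m k) * cell_width m k) * slope m k = 1 / 2"
        using cells_left_end_slope[of m k] by (simp add: cells_width)
      then show "corner_const / 4 = (\<Sum>ij\<in>{..<cells m k} \<times> {..<cells m k}. slope m k * (cell_width m k / 2) * corner_const)"
        by (simp add: card_cartesian_product field_simps)
    qed simp
    also have "\<dots> = (\<Sum>(k, ij)\<in>?I. slope m k * (cell_width m k / 2) * corner_const)"
      by (rule sum.Sigma) auto
    also have "\<dots> \<le> (\<Sum>c\<in>?I. measure M (quarter_cell m c))"
    proof (rule sum_mono)
      fix c assume "c \<in> ?I"
      then obtain k i j where "c = (k, i, j)" "i < cells m k" "j < cells m k" by auto
      then show "(case c of (k, ij) \<Rightarrow> slope m k * (cell_width m k / 2) * corner_const) \<le> measure M (quarter_cell m c)"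
        using measure_quarter_cell[OF M eq] by simp
    qed
    also have "\<dots> = measure M (\<Union>c\<in>?I. quarter_cell m c)"
    proof (rule M.finite_measure_finite_Union[symmetric])
      show "disjoint_family_on (quarter_cell m) ?I"
        using quarter_cells_disjoint by (rule disjoint_family_on_mono[rotated]) auto
    qed (auto simp: sets quarter_cell_def)
    also have "\<dots> \<le> measure M (space M)" by (rule M.bounded_measure)
    finally show ?thesis .
  qed
  obtain K where "measure M (space M) < real K * (corner_const / 4)"
    using reals_Archimedean3[of "corner_const / 4"] corner_const_pos by auto
  with le[of K] show False by simp
qed

theorem proposition16:
  fixes \<rho> :: "real \<times> real \<Rightarrow> real" and \<theta>\<^sub>1 \<theta>\<^sub>2 \<theta> :: real
  assumes "radial_kernel \<rho>"
    and "\<theta>\<^sub>1 > 0" and "\<theta>\<^sub>2 > 0" and "\<theta> = \<theta>\<^sub>1 + \<theta>\<^sub>2" and "\<theta> > 1"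
  shows "\<exists>u :: real \<times> real \<Rightarrow> real.
           compact (closed_support u) \<and> (\<exists>L. L-lipschitz_on UNIV u) \<and>
           energy \<rho> (1 + \<theta>) \<theta>\<^sub>1 \<theta>\<^sub>2 u < \<infinity> \<and>
           \<not> is_finite_radon_measure (mixed_derivative u)"
proof -
  obtain m :: nat where "1 < real m * (\<theta> - 1)"
    using reals_Archimedean3[of "\<theta> - 1"] assms(5) by auto
  then have "energy \<rho> (1 + \<theta>) \<theta>\<^sub>1 \<theta>\<^sub>2 (pyramids m) < \<infinity>"
    unfolding assms(4) using assms(1-4) by (intro energy_pyramids_finite) auto
  then show ?thesis
    using pyramids_compact_support pyramids_lipschitz pyramids_not_measure by blast
qed

end
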